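(* Let $n\ge 2$, let $1\le p<2$ and $q>p$, let $I\subset\mathbb{R}$ be measurable, and let $k_1,\dots,k_n$ be measurable functions on $I\times\mathbb{R}^+$ such that the operators \[ (K_if)(\lambda)=\int_{\mathbb{R}^+}k_i(\lambda,x)f(x)\,dx \] satisfy the bounds $\|K_if\|_{L^q(I,d\lambda)}\le C_i\|f\|_{L^p(\mathbb{R}^+,dx)}$ on functions $f$ of compact support, $i=1,\dots,n$. Let $A$ be any set of ordered pairs $\alpha=(i_\alpha,i'_\alpha)$ with $1\le i_\alpha,i'_\alpha\le n$, and let $T_n$ be the multilinear operator \[ T_n(f_1,\dots,f_n)(\lambda)=\int_{(\mathbb{R}^+)^n}\prod_{j=1}^{n}f_j(x_j)k_j(\lambda,x_j)\prod_{\alpha\in A}\chi_{\mathbb{R}^+}(x_{i_\alpha}-x_{i'_\alpha})\,dx_1\cdots dx_n. \] Then for any functions $f_i\in L^p(\mathbb{R}^+,dx)$, $i=1,\dots,n$, such that the integral defining $T_n(f_1,\dots,f_n)(\lambda)$ converges absolutely for almost every $\lambda\in I$, we have \[ \|T_n(f_1,\dots,f_n)\|_{L^{s_n}(I,d\lambda)}\le C_n\prod_{i=1}^{n}\|f_i\|_{p}, \] where $s_n^{-1}=nq^{-1}$. For the given $p,q$, the constant $C_n$ depends only on $n$ and on the constants $C_i$ in the norm bounds for the operators $K_i$.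
   Context: $\mathbb{R}^+=(0,\infty)$ and $\chi_E$ is the characteristic function of $E$. Here $s_n<1$ is allowed, with $\|g\|_s=(\int|g|^s)^{1/s}$ also for $0<s<1$. *)

theory Defs
  imports "HOL-Analysis.Analysis"
begin

abbreviation Rplus :: "real measure" where
  "Rplus \<equiv> lebesgue_on {0<..}"

definition in_Lp :: "real \<Rightarrow> 'a measure \<Rightarrow> ('a \<Rightarrow> complex) \<Rightarrow> bool" where
  "in_Lp r M g \<longleftrightarrow> g \<in> borel_measurable M \<and> integrable M (\<lambda>x. norm (g x) powr r)"

text \<open>The exponent may be any positive real, so for r < 1 this is only a quasinorm. The value is
  meaningful only together with \<^const>\<open>in_Lp\<close>, since divergent integrals evaluate to 0.\<close>
definition Lp_norm :: "real \<Rightarrow> 'a measure \<Rightarrow> ('a \<Rightarrow> complex) \<Rightarrow> real" where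
  "Lp_norm r M g = (\<integral>x. norm (g x) powr r \<partial>M) powr (1 / r)"

definition compactly_supported :: "(real \<Rightarrow> complex) \<Rightarrow> bool" where
  "compactly_supported f \<longleftrightarrow> (\<exists>S. compact S \<and> S \<subseteq> {0<..} \<and> (\<forall>x\<in>{0<..} - S. f x = 0))"

definition kernel_op :: "(real \<Rightarrow> real \<Rightarrow> complex) \<Rightarrow> (real \<Rightarrow> complex) \<Rightarrow> real \<Rightarrow> complex" where
  "kernel_op k f l = (\<integral>x. k l x * f x \<partial>Rplus)"

text \<open>The almost everywhere integrability clause says that the integral operator is genuinely
  defined on the functions considered; without it the convention that divergent integrals
  are 0 would allow kernels whose operators do not exist.\<close>
definition kernel_bounded ::
  "real \<Rightarrow> real \<Rightarrow> real set \<Rightarrow> (real \<Rightarrow> real \<Rightarrow> complex) \<Rightarrow> real \<Rightarrow> bool" where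
  "kernel_bounded p q I k C \<longleftrightarrow>
     (\<forall>f. in_Lp p Rplus f \<and> compactly_supported f \<longrightarrow>
        (AE l in lebesgue_on I. integrable Rplus (\<lambda>x. k l x * f x)) \<and>
        in_Lp q (lebesgue_on I) (kernel_op k f) \<and>
        Lp_norm q (lebesgue_on I) (kernel_op k f) \<le> C * Lp_norm p Rplus f)"

text \<open>Points of the n-fold product of the half-line are functions on the index set {1..n}. The
  product measure is not completed; this does not affect integrals, because the integrand below
  is measurable for it whenever all f j and k j l are Lebesgue measurable.\<close>
abbreviation Rplus_power :: "nat \<Rightarrow> (nat \<Rightarrow> real) measure" where
  "Rplus_power n \<equiv> Pi\<^sub>M {1..n} (\<lambda>_. Rplus)"

definition multi_integrand ::
  "nat \<Rightarrow> (nat \<times> nat) set \<Rightarrow> (nat \<Rightarrow> real \<Rightarrow> real \<Rightarrow> complex) \<Rightarrow> (nat \<Rightarrow> real \<Rightarrow> complex)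
     \<Rightarrow> real \<Rightarrow> (nat \<Rightarrow> real) \<Rightarrow> complex" where
  "multi_integrand n A k f l x =
     (\<Prod>j\<in>{1..n}. f j (x j) * k j l (x j)) *
     (\<Prod>(i, i')\<in>A. indicator {0<..} (x i - x i'))"

definition multi_op ::
  "nat \<Rightarrow> (nat \<times> nat) set \<Rightarrow> (nat \<Rightarrow> real \<Rightarrow> real \<Rightarrow> complex) \<Rightarrow> (nat \<Rightarrow> real \<Rightarrow> complex)
     \<Rightarrow> real \<Rightarrow> complex" where
  "multi_op n A k f l = (\<integral>x. multi_integrand n A k f l x \<partial>Rplus_power n)"

end

theory Submission
  imports Defs
begin

text \<open>
  The argument follows Christ and Kiselev. After truncation the \<open>f\<^sub>i\<close> have compact support in the
  half-line and all integrals \<open>\<integral> k\<^sub>i(\<lambda>, x) f\<^sub>i(x) dx\<close> converge absolutely. Choose an increasing coordinate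
  \<open>\<Phi>\<close> in which every dyadic interval of length \<open>2\<^sup>-\<^sup>m\<close> carries at most a multiple of \<open>2\<^sup>-\<^sup>m\<close> of the
  normalized mass of every \<open>|f\<^sub>i|\<^sup>p\<close>. Replacing the order constraints on points by those on the dyadic
  intervals of generation \<open>M\<close> turns \<open>T\<^sub>n\<close> into a finite sum \<open>S\<^sub>M\<close> of products of values of the \<open>K\<^sub>i\<close>,
  and \<open>S\<^sub>M \<rightarrow> T\<^sub>n\<close> pointwise. Splitting the root interval into halves expresses an ordered sum over
  an index set \<open>W\<close> through products of ordered sums over \<open>U\<close> and \<open>W - U\<close> on the two halves. With
  \<open>r = min q 2\<close> and some \<open>\<theta> > 1\<close>, induction over the tree bounds \<open>|S\<^sub>M|\<close> by a constant times
  \<open>B\<^bsup>n/r\<^esup>\<close>, where \<open>B = \<Sum>\<^sub>m \<theta>\<^sup>m \<Sum>\<^sub>E \<Sum>\<^sub>i |K\<^sub>i (f\<^sub>i \<chi>\<^sub>E)|\<^sup>r\<close> runs over all dyadic intervals; the factor \<open>\<theta>\<close>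
  gained at each step absorbs the terms with \<open>\<emptyset> \<noteq> U \<noteq> W\<close>. Since \<open>p < r \<le> q\<close>, Minkowski's inequality
  bounds the norm of \<open>B\<close> in \<open>L\<^bsup>q/r\<^esup>\<close> by a geometric series, independently of \<open>M\<close>, and Fatou's lemma
  passes to the limit.
\<close>

subsection \<open>Ordered sums over dyadic blocks\<close>

text \<open>Leaves below node \<open>j\<close> at height \<open>d\<close> of a binary tree;
  \<open>d\<close> counts upwards from the leaves, so a recursion on \<open>d\<close> starts at
  single cells.\<close>

definition block :: "nat \<Rightarrow> nat \<Rightarrow> nat set" where
  "block d j = {j * 2 ^ d..<Suc j * 2 ^ d}"

text \<open>Pairs with an entry outside \<open>W\<close> are ignored, so that both pieces of a split
  index set again carry constraints of this shape.\<close>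

definition order_ok :: "('i \<times> 'i) set \<Rightarrow> 'i set \<Rightarrow> ('i \<Rightarrow> 'b::linorder) \<Rightarrow> bool" where
  "order_ok A W v \<longleftrightarrow> (\<forall>(i, i')\<in>A. i \<in> W \<longrightarrow> i' \<in> W \<longrightarrow> v i' < v i)"

definition ordered_sum ::
  "('i \<times> 'i) set \<Rightarrow> ('i \<Rightarrow> nat \<Rightarrow> complex) \<Rightarrow> 'i set \<Rightarrow> nat set \<Rightarrow> complex" where
  "ordered_sum A a W S =
     (\<Sum>v\<in>Pi\<^sub>E W (\<lambda>_. S). of_bool (order_ok A W v) * (\<Prod>i\<in>W. a i (v i)))"

text \<open>The quantity \<open>B\<close> of the overview for the subtree below node
  \<open>j\<close>: each generation below the root contributes one more factor \<theta>.\<close>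

primrec tree_sum ::
  "real \<Rightarrow> real \<Rightarrow> 'i set \<Rightarrow> ('i \<Rightarrow> nat \<Rightarrow> complex) \<Rightarrow> nat \<Rightarrow> nat \<Rightarrow> real" where
  "tree_sum \<theta> r J a 0 j = (\<Sum>i\<in>J. norm (a i j) powr r)"
| "tree_sum \<theta> r J a (Suc d) j =
     (\<Sum>i\<in>J. norm (\<Sum>m\<in>block (Suc d) j. a i m) powr r) +
     \<theta> * (tree_sum \<theta> r J a d (2 * j) + tree_sum \<theta> r J a d (Suc (2 * j)))"

text \<open>Indexed by the number of variables. The increment is chosen so that
  \<open>2 ^ Suc w\<close> cross terms of size \<open>(tree_const \<theta> w)\<^sup>2\<close> are
  paid for by the surplus \<open>(\<theta> - 1) * tree_const \<theta> (Suc w)\<close>.\<close>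

primrec tree_const :: "real \<Rightarrow> nat \<Rightarrow> real" where
  "tree_const \<theta> 0 = 1"
| "tree_const \<theta> (Suc w) = tree_const \<theta> w + 2 ^ Suc w * (tree_const \<theta> w)\<^sup>2 / (\<theta> - 1)"

section \<open>Elementary facts about blocks, tree sums and ordered sums\<close>

lemma finite_block [simp]: "finite (block d j)"
  by (simp add: block_def)

lemma block_0 [simp]: "block 0 j = {j}"
  by (auto simp: block_def)

lemma block_Suc: "block (Suc d) j = block d (2 * j) \<union> block d (Suc (2 * j))"
  by (auto simp: block_def algebra_simps)

lemma block_halves_less: "x \<in> block d (2 * j) \<Longrightarrow> y \<in> block d (Suc (2 * j)) \<Longrightarrow> x < y"
  by (auto simp: block_def)

lemma tree_sum_nonneg: "\<theta> \<ge> 0 \<Longrightarrow> tree_sum \<theta> r J a d j \<ge> 0"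
  by (induction d arbitrary: j) (auto intro!: add_nonneg_nonneg mult_nonneg_nonneg sum_nonneg)

lemma norm_block_sum_le_tree_sum:
  assumes "\<theta> \<ge> 0" "finite J" "i \<in> J" "r > 0"
  shows "norm (\<Sum>m\<in>block d j. a i m) \<le> tree_sum \<theta> r J a d j powr (1 / r)"
proof -
  have "norm (\<Sum>m\<in>block d j. a i m) powr r \<le> (\<Sum>i\<in>J. norm (\<Sum>m\<in>block d j. a i m) powr r)"
    by (rule member_le_sum) (use assms in auto)
  also have "\<dots> \<le> tree_sum \<theta> r J a d j"
    using assms by (cases d) (auto intro!: mult_nonneg_nonneg add_nonneg_nonneg tree_sum_nonneg)
  finally have "(norm (\<Sum>m\<in>block d j. a i m) powr r) powr (1 / r) \<le> tree_sum \<theta> r J a d j powr (1 / r)"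
    using assms by (intro powr_mono2) auto
  then show ?thesis
    using assms by (simp add: powr_powr)
qed

lemma tree_const_ge_1: "\<theta> > 1 \<Longrightarrow> tree_const \<theta> w \<ge> 1"
proof (induction w)
  case (Suc w)
  have "0 \<le> 2 ^ Suc w * (tree_const \<theta> w)\<^sup>2 / (\<theta> - 1)"
    using Suc.prems by simp
  then show ?case
    using Suc by (simp del: power_Suc add: add_increasing2)
qed simp

lemma tree_const_mono:
  assumes "\<theta> > 1" "v \<le> w" shows "tree_const \<theta> v \<le> tree_const \<theta> w"
  using assms(2)
proof (induction rule: dec_induct)
  case (step w)
  have "0 \<le> 2 ^ Suc w * (tree_const \<theta> w)\<^sup>2 / (\<theta> - 1)"
    using assms by simp
  then show ?case
    using step by (simp del: power_Suc)
qed simp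

text \<open>After division by \<open>a + b\<close> the claim follows from
  \<open>x powr t \<le> x\<close> on the unit interval.\<close>

lemma superadditive_powr:
  fixes a b t :: real
  assumes "a \<ge> 0" "b \<ge> 0" "t \<ge> 1"
  shows "a powr t + b powr t \<le> (a + b) powr t"
proof (cases "a + b = 0")
  case False
  then have s: "a + b > 0" using assms by simp
  have *: "x powr t \<le> x / (a + b) * (a + b) powr t" if "0 \<le> x" "x \<le> a + b" for x
  proof -
    have "(x / (a + b)) powr t \<le> (x / (a + b)) powr 1"
      using that s assms by (intro powr_mono') auto
    then show ?thesis
      using that s by (simp add: powr_divide field_simps)
  qed
  have "a powr t + b powr t \<le> (a / (a + b) + b / (a + b)) * (a + b) powr t"
    using *[of a] *[of b] assms by (simp add: distrib_right)
  also have "a / (a + b) + b / (a + b) = 1"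
    using s by (simp add: add_divide_distrib[symmetric])
  finally show ?thesis by simp
next
  case True
  then have "a = 0" "b = 0" using assms by auto
  then show ?thesis by simp
qed

lemma ordered_sum_empty [simp]: "ordered_sum A a {} S = 1"
  by (simp add: ordered_sum_def order_ok_def)

text \<open>Equality can fail only when \<open>(i, i) \<in> A\<close>: that constraint is
  unsatisfiable and the left side is 0.\<close>

lemma norm_ordered_sum_singleton:
  assumes "finite S"
  shows "norm (ordered_sum A a {i} S) \<le> norm (\<Sum>m\<in>S. a i m)"
proof -
  have "ordered_sum A a {i} S = of_bool ((i, i) \<notin> A) * (\<Sum>v\<in>Pi\<^sub>E {i} (\<lambda>_. S). \<Prod>i\<in>{i}. a i (v i))"
    unfolding ordered_sum_def sum_distrib_left
    by (intro sum.cong refl arg_cong2[where f = "(*)"]) (auto simp: order_ok_def)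
  also have "(\<Sum>v\<in>Pi\<^sub>E {i} (\<lambda>_. S). \<Prod>i\<in>{i}. a i (v i)) = (\<Prod>i\<in>{i}. \<Sum>m\<in>S. a i m)"
    by (rule prod_sum_PiE[symmetric]) (use assms in auto)
  finally show ?thesis by (simp add: norm_mult)
qed

text \<open>The set \<open>U\<close> collects the indices sent to the lower half.\<close>
lemma ordered_sum_Un:
  fixes A :: "('i \<times> 'i) set"
  assumes "finite W" "finite S" "finite S'" and less: "\<And>x y. x \<in> S \<Longrightarrow> y \<in> S' \<Longrightarrow> x < y"
  shows "ordered_sum A a W (S \<union> S') =
    (\<Sum>U\<in>Pow W. of_bool (\<forall>(i, i')\<in>A. i \<in> U \<longrightarrow> i' \<notin> W - U) *
       (ordered_sum A a U S * ordered_sum A a (W - U) S'))"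
proof -
  let ?t = "\<lambda>W v. of_bool (order_ok A W v) * (\<Prod>i\<in>W. a i (v i))"
  let ?ok = "\<lambda>U. \<forall>(i, i')\<in>A. i \<in> U \<longrightarrow> i' \<notin> W - U"
  let ?D = "Sigma (Pow W) (\<lambda>U. Pi\<^sub>E U (\<lambda>_. S) \<times> Pi\<^sub>E (W - U) (\<lambda>_. S'))"
  \<comment> \<open>\<open>?h\<close> glues assignments on the two halves, and \<open>?g\<close>
    recovers the pieces by testing which values lie in \<open>S\<close>; they are mutually inverse
    because \<open>S\<close> and \<open>S'\<close> are disjoint.\<close>
  let ?h = "\<lambda>(U, u, v) i. if i \<in> U then u i else v i"
  let ?g = "\<lambda>w. ({i\<in>W. w i \<in> S}, restrict w {i\<in>W. w i \<in> S}, restrict w (W - {i\<in>W. w i \<in> S}))"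
  have disj: "S \<inter> S' = {}"
    using less by blast
  have "(\<Sum>U\<in>Pow W. of_bool (?ok U) * (ordered_sum A a U S * ordered_sum A a (W - U) S')) =
     (\<Sum>U\<in>Pow W. \<Sum>(u, v)\<in>Pi\<^sub>E U (\<lambda>_. S) \<times> Pi\<^sub>E (W - U) (\<lambda>_. S').
        of_bool (?ok U) * (?t U u * ?t (W - U) v))"
    unfolding ordered_sum_def sum_product unfolding sum_distrib_left sum.cartesian_product
    by (simp only: case_prod_unfold)
  also have "\<dots> = (\<Sum>(U, u, v)\<in>?D. of_bool (?ok U) * (?t U u * ?t (W - U) v))"
    using assms(1-3) by (subst sum.Sigma) (auto simp: case_prod_unfold intro!: finite_PiE intro: finite_subset)
  also have "\<dots> = (\<Sum>w\<in>Pi\<^sub>E W (\<lambda>_. S \<union> S'). ?t W w)"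
  proof (rule sum.reindex_bij_witness[where i = ?g and j = ?h])
    fix z assume z: "z \<in> ?D"
    obtain U u v where z_eq: "z = (U, u, v)" by (cases z) auto
    with z have U: "U \<subseteq> W" and u: "u \<in> Pi\<^sub>E U (\<lambda>_. S)" and v: "v \<in> Pi\<^sub>E (W - U) (\<lambda>_. S')"
      by auto
    have uS: "u i \<in> S" if "i \<in> U" for i using u that by auto
    have vS': "v i \<in> S'" if "i \<in> W" "i \<notin> U" for i using v that by auto
    have US: "{i\<in>W. ?h (U, u, v) i \<in> S} = U"
      using U uS vS' disj by auto
    show "?g (?h z) = z"
      unfolding z_eq US using U u v by (auto simp: PiE_def extensional_def fun_eq_iff)
    show "?h z \<in> Pi\<^sub>E W (\<lambda>_. S \<union> S')"
      unfolding z_eq using U u v by (auto simp: PiE_def extensional_def Pi_def)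
    have "order_ok A W (?h (U, u, v)) \<longleftrightarrow> ?ok U \<and> order_ok A U u \<and> order_ok A (W - U) v"
      (is "?l \<longleftrightarrow> ?r")
    proof
      assume ?l
      then have l: "?h (U, u, v) i' < ?h (U, u, v) i" if "(i, i') \<in> A" "i \<in> W" "i' \<in> W" for i i'
        using that unfolding order_ok_def by blast
      \<comment> \<open>A pair whose larger entry is sent to the lower half and whose smaller entry
        is sent to the upper half contradicts the order of the halves.\<close>
      have False if "(i, i') \<in> A" "i \<in> U" "i' \<in> W - U" for i i'
        using l[of i i'] less[OF uS[of i] vS'[of i']] that U by auto
      then have "?ok U" by blast
      moreover have "order_ok A U u"
        unfolding order_ok_def
      proof clarify
        fix i i' assume "(i, i') \<in> A" "i \<in> U" "i' \<in> U"
        then show "u i' < u i" using l[of i i'] U by auto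
      qed
      moreover have "order_ok A (W - U) v"
        unfolding order_ok_def
      proof clarify
        fix i i' assume "(i, i') \<in> A" "i \<in> W" "i \<notin> U" "i' \<in> W" "i' \<notin> U"
        then show "v i' < v i" using l[of i i'] by auto
      qed
      ultimately show ?r by blast
    next
      assume r: ?r
      have "?h (U, u, v) i' < ?h (U, u, v) i" if i: "(i, i') \<in> A" "i \<in> W" "i' \<in> W" for i i'
      proof -
        consider "i \<in> U" "i' \<in> U" | "i \<notin> U" "i' \<notin> U" | "i \<in> U" "i' \<notin> U" | "i \<notin> U" "i' \<in> U"
          by blast
        then show "?h (U, u, v) i' < ?h (U, u, v) i"
        proof cases
          case 1 then show ?thesis using r i unfolding order_ok_def by auto
        next
          case 2 then show ?thesis using r i unfolding order_ok_def by auto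
        next
          case 3 then show ?thesis using r i by blast
        next
          \<comment> \<open>The opposite crossing satisfies its constraint automatically, so it
            leaves no trace in the product.\<close>
          case 4 then show ?thesis using less[OF uS[of i'] vS'[of i]] i by simp
        qed
      qed
      then show ?l unfolding order_ok_def by blast
    qed
    moreover have "(\<Prod>i\<in>W. a i (?h (U, u, v) i)) = (\<Prod>i\<in>U. a i (u i)) * (\<Prod>i\<in>W - U. a i (v i))"
    proof -
      have "(\<Prod>i\<in>W. a i (?h (U, u, v) i)) =
          (\<Prod>i\<in>W - U. a i (?h (U, u, v) i)) * (\<Prod>i\<in>U. a i (?h (U, u, v) i))"
        using U assms(1) by (rule prod.subset_diff)
      then show ?thesis by (simp add: mult.commute)
    qed
    ultimately show "?t W (?h z) = (case z of (U, u, v) \<Rightarrow> of_bool (?ok U) * (?t U u * ?t (W - U) v))"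
      unfolding z_eq by (simp add: of_bool_conj)
  next
    fix w assume w: "w \<in> Pi\<^sub>E W (\<lambda>_. S \<union> S')"
    show "?h (?g w) = w"
      using w by (auto simp: PiE_def extensional_def fun_eq_iff)
    show "?g w \<in> ?D"
      using w by (auto simp: PiE_def extensional_def)
  qed
  finally show ?thesis
    unfolding ordered_sum_def by simp
qed

text \<open>Induction on the height, for all \<open>W\<close> at once: a split with both parts
  nonempty involves smaller index sets and hence smaller constants, while the two trivial splits
  keep \<open>W\<close> and its constant.\<close>

lemma norm_ordered_sum_le_tree_sum:
  fixes a :: "'i \<Rightarrow> nat \<Rightarrow> complex"
  assumes "finite J" "\<theta> > 1" "0 < r" "r \<le> 2" "W \<subseteq> J" "W \<noteq> {}"
  shows "norm (ordered_sum A a W (block d j))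
           \<le> tree_const \<theta> (card W) * tree_sum \<theta> r J a d j powr (card W / r)"
  using assms(5,6)
proof (induction d arbitrary: j W)
  case 0
  let ?B = "tree_sum \<theta> r J a 0 j"
  have finW: "finite W" using 0 assms(1) finite_subset by blast
  have pt: "Pi\<^sub>E W (\<lambda>_. {j}) = {restrict (\<lambda>_. j) W}"
    using PiE_singleton[of "restrict (\<lambda>_. j) W" W] by (simp cong: PiE_cong)
  have "norm (ordered_sum A a W (block 0 j)) \<le> (\<Prod>i\<in>W. norm (a i j))"
    unfolding ordered_sum_def block_0 pt by (subst sum.insert) (auto simp: norm_mult prod_norm)
  also have "\<dots> \<le> (\<Prod>i\<in>W. ?B powr (1 / r))"
    using norm_block_sum_le_tree_sum[of \<theta> J _ r a 0 j] 0 assms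
    by (intro prod_mono) auto
  \<comment> \<open>For \<open>?B = 0\<close> both sides are 0, the left one because
    \<open>W\<close> is nonempty.\<close>
  also have "\<dots> = ?B powr (card W / r)"
    using 0 finW by (cases "?B = 0") (simp_all add: powr_power card_gt_0_iff power_0_left del: tree_sum.simps)
  also have "\<dots> \<le> tree_const \<theta> (card W) * ?B powr (card W / r)"
    using tree_const_ge_1[OF assms(2), of "card W"] mult_right_mono[of 1 "tree_const \<theta> (card W)"] by simp
  finally show ?case .
next
  case (Suc d)
  let ?B = "tree_sum \<theta> r J a (Suc d) j"
  let ?L = "tree_sum \<theta> r J a d (2 * j)" and ?R = "tree_sum \<theta> r J a d (Suc (2 * j))"
  let ?c = "tree_const \<theta>" and ?w = "card W"
  have finW: "finite W" using Suc.prems assms(1) finite_subset by blast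
  have LR: "?L \<ge> 0" "?R \<ge> 0" using assms(2) by (auto intro: tree_sum_nonneg)
  show ?case
  proof (cases "?w = 1")
    case True
    then obtain i where i: "W = {i}" by (auto simp: card_1_singleton_iff)
    have "norm (ordered_sum A a W (block (Suc d) j)) \<le> ?B powr (1 / r)"
      unfolding i using norm_ordered_sum_singleton[of "block (Suc d) j" A a i]
        norm_block_sum_le_tree_sum[of \<theta> J i r a "Suc d" j] assms Suc.prems i by (auto simp del: tree_sum.simps)
    also have "\<dots> \<le> ?c ?w * ?B powr (1 / r)"
      using tree_const_ge_1[OF assms(2), of ?w] mult_right_mono[of 1 "?c ?w"] by simp
    finally show ?thesis using True by simp
  next
    case False
    then obtain w' where w': "?w = Suc w'" "w' \<ge> 1"
      using Suc.prems finW by (cases "card W") auto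
    define t where "t = ?w / r"
    have t: "t \<ge> 1" using w' assms by (simp add: t_def field_simps)
    let ?X = "(?L + ?R) powr t"
    let ?P = "Pow W - {{}, W}"
    have "norm (ordered_sum A a W (block (Suc d) j)) \<le>
       (\<Sum>U\<in>Pow W. norm (ordered_sum A a U (block d (2 * j))) *
                      norm (ordered_sum A a (W - U) (block d (Suc (2 * j)))))"
      unfolding block_Suc
      by (subst ordered_sum_Un)
        (use finW block_halves_less in \<open>auto intro!: sum_norm_le simp: norm_mult simp del: sum_of_bool_mult_eq\<close>)
    also have "\<dots> = norm (ordered_sum A a W (block d (2 * j))) +
                     norm (ordered_sum A a W (block d (Suc (2 * j)))) +
       (\<Sum>U\<in>?P. norm (ordered_sum A a U (block d (2 * j))) *
                      norm (ordered_sum A a (W - U) (block d (Suc (2 * j)))))"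
    proof -
      have "sum F (Pow W) = F W + F {} + sum F ?P" for F :: "'i set \<Rightarrow> real"
        using sum.subset_diff[of "{{}, W}" "Pow W" F] Suc.prems finW by simp
      then show ?thesis by simp
    qed
    \<comment> \<open>The trivial splits keep separate powers of \<open>?L\<close> and
      \<open>?R\<close>. In a cross term the exponents \<open>card U / r\<close> and
      \<open>card (W - U) / r\<close> add up to \<open>t\<close>.\<close>
    also have "\<dots> \<le> ?c ?w * ?L powr t + ?c ?w * ?R powr t + (\<Sum>U\<in>?P. (?c w')\<^sup>2 * ?X)"
    proof (intro add_mono sum_mono)
      fix U assume U: "U \<in> ?P"
      then have Us: "U \<subseteq> W" "U \<noteq> {}" "W - U \<noteq> {}" "W - U \<subseteq> W" by auto
      have finU: "finite U" using Us finW finite_subset by blast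
      have cardU: "card U \<le> w'" "card (W - U) \<le> w'" "card U + card (W - U) = ?w"
      proof -
        show *: "card U + card (W - U) = ?w"
          using Us finW finU by (simp add: card_Diff_subset card_mono)
        have "card U > 0" "card (W - U) > 0"
          using Us finU finW by (auto simp: card_gt_0_iff)
        with * w' show "card U \<le> w'" "card (W - U) \<le> w'" by auto
      qed
      have b: "norm (ordered_sum A a V (block d j')) \<le> ?c w' * (?L + ?R) powr (card V / r)"
        if "V \<subseteq> W" "V \<noteq> {}" "card V \<le> w'" "j' = 2 * j \<or> j' = Suc (2 * j)" for V j'
      proof -
        have "norm (ordered_sum A a V (block d j')) \<le> ?c (card V) * tree_sum \<theta> r J a d j' powr (card V / r)"
          using that Suc.prems by (intro Suc.IH) auto
        also have "\<dots> \<le> ?c w' * (?L + ?R) powr (card V / r)"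
          using that LR assms tree_const_ge_1[OF assms(2), of "card V"] tree_const_ge_1[OF assms(2), of w']
          by (intro mult_mono tree_const_mono powr_mono2) auto
        finally show ?thesis .
      qed
      have "norm (ordered_sum A a U (block d (2 * j))) * norm (ordered_sum A a (W - U) (block d (Suc (2 * j))))
         \<le> (?c w' * (?L + ?R) powr (card U / r)) * (?c w' * (?L + ?R) powr (card (W - U) / r))"
        using Us cardU tree_const_ge_1[OF assms(2), of w'] by (intro mult_mono b) auto
      also have "\<dots> = (?c w')\<^sup>2 * ?X"
        using cardU(3)[symmetric] by (simp add: t_def power2_eq_square powr_add add_divide_distrib)
      finally show "norm (ordered_sum A a U (block d (2 * j))) *
          norm (ordered_sum A a (W - U) (block d (Suc (2 * j)))) \<le> (?c w')\<^sup>2 * ?X" .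
    qed (use Suc.IH Suc.prems in \<open>auto simp: t_def\<close>)
    also have "\<dots> \<le> ?c ?w * ?X + 2 ^ ?w * ((?c w')\<^sup>2 * ?X)"
    proof (intro add_mono)
      have "card ?P \<le> 2 ^ ?w"
        using card_mono[of "Pow W" ?P] finW by (auto simp: card_Pow)
      then have "real (card ?P) \<le> 2 ^ ?w" by (metis of_nat_le_iff of_nat_numeral of_nat_power)
      then show "(\<Sum>U\<in>?P. (?c w')\<^sup>2 * ?X) \<le> 2 ^ ?w * ((?c w')\<^sup>2 * ?X)"
        by (simp only: sum_constant) (intro mult_right_mono, auto)
      show "?c ?w * ?L powr t + ?c ?w * ?R powr t \<le> ?c ?w * ?X"
        using superadditive_powr[OF LR t] tree_const_ge_1[OF assms(2), of ?w]
        by (simp flip: distrib_left)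
    qed
    \<comment> \<open>The recursion defining \<open>tree_const\<close> is solved for the cross term
      coefficient.\<close>
    also have "\<dots> \<le> \<theta> * ?c ?w * ?X"
    proof -
      have "2 ^ ?w * (?c w')\<^sup>2 = (?c ?w - ?c w') * (\<theta> - 1)"
        using assms(2) by (simp add: w' del: power_Suc)
      also have "\<dots> \<le> ?c ?w * (\<theta> - 1)"
        using assms(2) tree_const_ge_1[OF assms(2), of w'] by (intro mult_right_mono) auto
      finally have "?c ?w + 2 ^ ?w * (?c w')\<^sup>2 \<le> \<theta> * ?c ?w" by (simp add: algebra_simps)
      then have "(?c ?w + 2 ^ ?w * (?c w')\<^sup>2) * ?X \<le> \<theta> * ?c ?w * ?X"
        by (intro mult_right_mono) auto
      then show ?thesis by (simp add: algebra_simps)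
    qed
    \<comment> \<open>Raising \<theta> to the power \<open>t \<ge> 1\<close> lets it move inside,
      where it becomes the weight of the two children in \<open>tree_sum\<close>.\<close>
    also have "\<dots> \<le> \<theta> powr t * ?c ?w * ?X"
    proof -
      have "\<theta> powr 1 \<le> \<theta> powr t" using assms(2) t by (intro powr_mono) auto
      then show ?thesis
        using assms(2) tree_const_ge_1[OF assms(2), of ?w] by (intro mult_right_mono) auto
    qed
    also have "\<dots> = ?c ?w * (\<theta> * (?L + ?R)) powr t"
      using LR assms(2) by (simp add: powr_mult)
    also have "\<dots> \<le> ?c ?w * ?B powr t"
      using LR assms(2) t tree_const_ge_1[OF assms(2), of ?w]
      by (intro mult_left_mono powr_mono2) (auto intro!: sum_nonneg)
    finally show ?thesis by (simp add: t_def)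
  qed
qed

subsection \<open>Minkowski's inequality and passage to the limit\<close>

text \<open>For positive points this is \<open>powr_convex\<close>. If one of the points is 0, it
  reduces to \<open>c powr t \<le> c\<close> for \<open>c\<close> in the unit interval.\<close>

lemma convex_on_powr_nonneg:
  assumes "t \<ge> 1" shows "convex_on {0..} (\<lambda>x::real. x powr t)"
proof (rule convex_onI)
  fix u x y :: real assume u: "0 < u" "u < 1" and xy: "x \<in> {0..}" "y \<in> {0..}"
  have scale: "(c * z) powr t \<le> c * z powr t" if "0 \<le> c" "c \<le> 1" "0 \<le> z" for c z :: real
  proof -
    have "c powr t \<le> c powr 1"
      using that assms by (intro powr_mono') auto
    then show ?thesis
      using that by (auto simp: powr_mult intro: mult_right_mono)
  qed
  show "((1 - u) *\<^sub>R x + u *\<^sub>R y) powr t \<le> (1 - u) * x powr t + u * y powr t"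
  proof (cases "x = 0 \<or> y = 0")
    case True
    then show ?thesis
      using u xy assms scale[of u y] scale[of "1 - u" x] by auto
  next
    case False
    then show ?thesis
      using convex_onD[OF powr_convex[OF assms], of u x y] u xy by auto
  qed
qed auto

text \<open>Minkowski's inequality, from Jensen's inequality with weights \<open>K e / \<Sum>K\<close> proportional to
  the norms.\<close>
lemma nn_integral_sum_powr_le:
  fixes y :: "'e \<Rightarrow> 'a \<Rightarrow> real"
  assumes "finite Z" "t \<ge> 1"
    and meas [measurable]: "\<And>e. e \<in> Z \<Longrightarrow> y e \<in> borel_measurable M"
    and nonneg: "\<And>e x. e \<in> Z \<Longrightarrow> y e x \<ge> 0"
    and K: "\<And>e. e \<in> Z \<Longrightarrow> K e > 0"
    and le: "\<And>e. e \<in> Z \<Longrightarrow> (\<integral>\<^sup>+x. ennreal (y e x powr t) \<partial>M) \<le> ennreal (K e powr t)"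
  shows "(\<integral>\<^sup>+x. ennreal ((\<Sum>e\<in>Z. y e x) powr t) \<partial>M) \<le> ennreal ((\<Sum>e\<in>Z. K e) powr t)"
proof (cases "Z = {}")
  case False
  define S where "S = (\<Sum>e\<in>Z. K e)"
  have S: "S > 0"
    unfolding S_def using False assms(1) K by (intro sum_pos) auto
  \<comment> \<open>The coefficient of \<open>y e x powr t\<close> after Jensen. Against
    \<open>K e powr t\<close> it leaves \<open>K e / S * S powr t\<close>, and the factors
    \<open>K e / S\<close> sum to 1.\<close>
  let ?w = "\<lambda>e. K e / S * (S / K e) powr t"
  have w: "?w e \<ge> 0" if "e \<in> Z" for e
    using K[OF that] S by simp
  have jensen: "(\<Sum>e\<in>Z. y e x) powr t \<le> (\<Sum>e\<in>Z. ?w e * y e x powr t)" for x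
  proof -
    have "(\<Sum>e\<in>Z. y e x) = (\<Sum>e\<in>Z. (K e / S) *\<^sub>R (S / K e * y e x))"
      using K S by (intro sum.cong) (auto simp: less_imp_neq[symmetric])
    also have "\<dots> powr t \<le> (\<Sum>e\<in>Z. K e / S * (S / K e * y e x) powr t)"
      using K S nonneg False assms(1)
      by (intro convex_on_sum[OF _ _ convex_on_powr_nonneg[OF assms(2)]])
        (auto simp: S_def less_imp_le simp flip: sum_divide_distrib)
    also have "\<dots> = (\<Sum>e\<in>Z. ?w e * y e x powr t)"
      using less_imp_le[OF K] less_imp_le[OF S] nonneg
      by (intro sum.cong refl) (simp add: powr_mult del: times_divide_eq_left times_divide_eq_right)
    finally show ?thesis .
  qed
  have "(\<integral>\<^sup>+x. ennreal ((\<Sum>e\<in>Z. y e x) powr t) \<partial>M)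
      \<le> (\<integral>\<^sup>+x. (\<Sum>e\<in>Z. ennreal (?w e) * ennreal (y e x powr t)) \<partial>M)"
  proof (rule nn_integral_mono)
    fix x
    have "(\<Sum>e\<in>Z. ennreal (?w e) * ennreal (y e x powr t)) = ennreal (\<Sum>e\<in>Z. ?w e * y e x powr t)"
      by (subst sum_ennreal[symmetric]) (intro mult_nonneg_nonneg w powr_ge_zero sum.cong refl
        ennreal_mult[symmetric]; assumption)+
    with ennreal_leI[OF jensen[of x]]
    show "ennreal ((\<Sum>e\<in>Z. y e x) powr t) \<le> (\<Sum>e\<in>Z. ennreal (?w e) * ennreal (y e x powr t))"
      by simp
  qed
  also have "\<dots> = (\<Sum>e\<in>Z. ennreal (?w e) * (\<integral>\<^sup>+x. ennreal (y e x powr t) \<partial>M))"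
    by (subst nn_integral_sum) (auto simp: nn_integral_cmult)
  also have "\<dots> \<le> (\<Sum>e\<in>Z. ennreal (?w e) * ennreal (K e powr t))"
    by (intro sum_mono mult_left_mono le) auto
  also have "\<dots> = ennreal (\<Sum>e\<in>Z. ?w e * K e powr t)"
    by (subst sum_ennreal[symmetric]) (intro mult_nonneg_nonneg w powr_ge_zero sum.cong refl
      ennreal_mult[symmetric]; assumption)+
  also have "(\<Sum>e\<in>Z. ?w e * K e powr t) = (\<Sum>e\<in>Z. K e / S * S powr t)"
  proof (intro sum.cong refl)
    fix e assume "e \<in> Z"
    from K[OF this] S show "?w e * K e powr t = K e / S * S powr t"
      by (simp add: powr_divide)
  qed
  also have "\<dots> = S powr t"
    using S by (simp add: S_def flip: sum_distrib_right sum_divide_distrib)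
  finally show ?thesis
    by (simp add: S_def)
qed (use assms in auto)

section \<open>Almost everywhere limits over a complete measure\<close>

lemma complete_measure_lebesgue_on:
  assumes "I \<in> sets lebesgue" shows "complete_measure (lebesgue_on I)"
proof
  fix A B assume "B \<subseteq> A" "A \<in> null_sets (lebesgue_on I)"
  then have "A \<in> null_sets lebesgue" "A \<subseteq> I"
    using assms null_sets_restrict_space[OF assms] by blast+
  with \<open>B \<subseteq> A\<close> have "B \<in> sets lebesgue" "B \<subseteq> I"
    using completion.complete2[of B A lborel] by auto
  then show "B \<in> sets (lebesgue_on I)"
    using assms by (simp add: sets_restrict_space_iff)
qed

lemma (in complete_measure) borel_measurable_AE_cong:
  assumes ae: "AE x in M. f x = g x" and f: "f \<in> borel_measurable M"
  shows "g \<in> borel_measurable M"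
proof (rule measurableI)
  fix B assume "B \<in> sets (borel :: 'b :: topological_space measure)"
  then show "g -` B \<inter> space M \<in> sets M"
    using ae by (intro in_sets_AE[OF _ measurable_sets[OF f]]) (auto elim: eventually_mono)
qed auto

text \<open>Completeness makes an almost everywhere limit measurable. The bound is Fatou's lemma,
  which needs no triangle inequality, so exponents \<open>s < 1\<close> are covered.\<close>

lemma powr_norm_limit_le:
  fixes u :: "nat \<Rightarrow> 'a \<Rightarrow> complex"
  assumes "complete_measure M" "s > 0"
    and meas [measurable]: "\<And>m. u m \<in> borel_measurable M"
    and lim: "AE x in M. (\<lambda>m. u m x) \<longlonglongrightarrow> g x"
    and le: "\<And>m. (\<integral>\<^sup>+x. ennreal (norm (u m x) powr s) \<partial>M) \<le> B"
  shows "g \<in> borel_measurable M" "(\<integral>\<^sup>+x. ennreal (norm (g x) powr s) \<partial>M) \<le> B"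
proof -
  interpret complete_measure M by fact
  show "g \<in> borel_measurable M"
  proof (rule borel_measurable_AE_cong)
    show "AE x in M. lim (\<lambda>m. u m x) = g x"
      using lim by eventually_elim (simp add: limI)
  qed measurable
  have "(\<integral>\<^sup>+x. ennreal (norm (g x) powr s) \<partial>M)
      = (\<integral>\<^sup>+x. liminf (\<lambda>m. ennreal (norm (u m x) powr s)) \<partial>M)"
  proof (rule nn_integral_cong_AE)
    show "AE x in M. ennreal (norm (g x) powr s) = liminf (\<lambda>m. ennreal (norm (u m x) powr s))"
      using lim
    proof eventually_elim
      fix x assume "(\<lambda>m. u m x) \<longlonglongrightarrow> g x"
      then have "(\<lambda>m. norm (u m x) powr s) \<longlonglongrightarrow> norm (g x) powr s"
        using assms(2) by (intro tendsto_powr2 tendsto_norm tendsto_const) auto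
      then have "(\<lambda>m. ennreal (norm (u m x) powr s)) \<longlonglongrightarrow> ennreal (norm (g x) powr s)"
        by (rule tendsto_ennrealI)
      then show "ennreal (norm (g x) powr s) = liminf (\<lambda>m. ennreal (norm (u m x) powr s))"
        by (intro lim_imp_Liminf[symmetric]) auto
    qed
  qed
  also have "\<dots> \<le> liminf (\<lambda>m. \<integral>\<^sup>+x. ennreal (norm (u m x) powr s) \<partial>M)"
    by (rule nn_integral_liminf) measurable
  also have "\<dots> \<le> limsup (\<lambda>m. \<integral>\<^sup>+x. ennreal (norm (u m x) powr s) \<partial>M)"
    by (simp add: Liminf_le_Limsup)
  also have "\<dots> \<le> B"
    by (rule Limsup_bounded) (simp add: le)
  finally show "(\<integral>\<^sup>+x. ennreal (norm (g x) powr s) \<partial>M) \<le> B" .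
qed

subsection \<open>Discretization of ordered integrals\<close>

text \<open>\<open>\<Phi>\<close> is a normalized primitive of \<open>h + 1 / R\<close>. The summand \<open>1 / R\<close> makes it strictly increasing even
  where \<open>h\<close> vanishes, so that comparing points amounts to comparing their \<open>\<Phi>\<close>-values.\<close>
lemma mass_coordinate:
  fixes h :: "real \<Rightarrow> real"
  assumes h: "integrable lebesgue h" and nonneg: "\<And>x. h x \<ge> 0"
    and c: "(\<integral>x. h x \<partial>lebesgue) \<le> c" and R: "R > 0"
  obtains \<Phi> where "continuous_on UNIV \<Phi>" "\<And>x. 0 \<le> \<Phi> x" "\<And>x. \<Phi> x < 1" "strict_mono_on {0..R} \<Phi>"
    "\<And>u v. u \<le> v \<Longrightarrow>
       (\<integral>x. h x * indicator {x\<in>{0..R}. u \<le> \<Phi> x \<and> \<Phi> x < v} x \<partial>lebesgue) \<le> (c + 2) * (v - u)"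
proof -
  let ?h = "\<lambda>x. h x + 1 / R"
  define G where "G x = integral {0..x} ?h / (c + 2)" for x
  \<comment> \<open>Clamping the argument to \<open>{0..R}\<close> makes the coordinate continuous
    with range in \<open>[0, 1)\<close> on the whole line.\<close>
  define \<Phi> where "\<Phi> x = G (max 0 (min x R))" for x
  have c0: "c \<ge> 0"
    using c Bochner_Integration.integral_nonneg[of lebesgue h, OF nonneg] by linarith
  have h_on: "h integrable_on {a..b}" for a b
    using integrable_on_lebesgue[OF h] by (rule integrable_on_subinterval) auto
  have h1_on: "?h integrable_on {a..b}" for a b
    by (intro integrable_add h_on) auto
  have h_int: "integral {a..b} h = (\<integral>x. h x * indicator {a..b} x \<partial>lebesgue)" for a b
  proof -
    have "set_integrable lebesgue {a..b} h"
      unfolding set_integrable_def using h by (intro integrable_mult_indicator) auto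
    from set_lebesgue_integral_eq_integral(2)[OF this] show ?thesis
      by (simp add: set_lebesgue_integral_def mult.commute)
  qed
  have diff: "G b - G a = integral {a..b} ?h / (c + 2)" if "0 \<le> a" "a \<le> b" for a b
    using Henstock_Kurzweil_Integration.integral_combine[OF that h1_on]
    by (simp add: G_def diff_divide_distrib[symmetric])
  have h1_eq: "integral {a..b} ?h = integral {a..b} h + (b - a) / R" if "a \<le> b" for a b
    using that by (subst Henstock_Kurzweil_Integration.integral_add[OF h_on]) auto
  have strict: "G a < G b" if "0 \<le> a" "a < b" for a b
  proof -
    have "integral {a..b} h \<ge> 0"
      by (intro Henstock_Kurzweil_Integration.integral_nonneg h_on nonneg)
    then have "integral {a..b} ?h > 0"
      using that R by (simp add: h1_eq add_nonneg_pos)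
    then have "0 < integral {a..b} ?h / (c + 2)"
      using c0 by (intro divide_pos_pos) auto
    then show ?thesis
      using diff[of a b] that by simp
  qed
  have G0: "G 0 = 0"
    by (simp add: G_def)
  \<comment> \<open>The summand \<open>1 / R\<close> adds mass 1 on \<open>{0..R}\<close>, for a
    total of at most \<open>c + 1\<close>; division by \<open>c + 2\<close> makes the inequality
    strict.\<close>
  have GR: "G R < 1"
  proof -
    have "integral {0..R} h \<le> (\<integral>x. h x \<partial>lebesgue)"
      unfolding h_int using h nonneg
      by (intro integral_mono integrable_real_mult_indicator) (auto simp: indicator_def)
    then have "integral {0..R} ?h \<le> c + 1"
      using R c by (simp add: h1_eq)
    then show ?thesis
      using c0 by (simp add: G_def field_simps)
  qed
  have mono: "G a \<le> G b" if "0 \<le> a" "a \<le> b" for a b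
    using strict[of a b] that by (cases "a = b") auto
  have cont_G: "continuous_on {0..R} G"
    unfolding G_def using c0 by (intro continuous_intros indefinite_integral_continuous_1 h1_on) auto
  have cont: "continuous_on UNIV \<Phi>"
    unfolding \<Phi>_def using R
    by (intro continuous_on_compose2[OF cont_G] continuous_intros) auto
  have \<Phi>_eq: "\<Phi> x = G x" if "x \<in> {0..R}" for x
    using that by (simp add: \<Phi>_def)
  show thesis
  proof
    show "continuous_on UNIV \<Phi>" by fact
    show "0 \<le> \<Phi> x" for x
      using mono[of 0 "max 0 (min x R)"] by (simp add: \<Phi>_def G0)
    show "\<Phi> x < 1" for x
      using mono[of "max 0 (min x R)" R] GR R by (simp add: \<Phi>_def)
    show "strict_mono_on {0..R} \<Phi>"
      by (rule strict_mono_onI) (simp add: \<Phi>_eq strict)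
    fix u v :: real assume uv: "u \<le> v"
    \<comment> \<open>The closed version \<open>?E'\<close> is compact, so its extreme points
      \<open>a\<close> and \<open>b\<close> are attained; \<open>?E\<close> lies in
      \<open>{a..b}\<close>, and the increment of \<Phi> from \<open>a\<close> to \<open>b\<close>
      is at most \<open>v - u\<close>.\<close>
    let ?E = "{x\<in>{0..R}. u \<le> \<Phi> x \<and> \<Phi> x < v}" and ?E' = "{x\<in>{0..R}. \<Phi> x \<in> {u..v}}"
    show "(\<integral>x. h x * indicator ?E x \<partial>lebesgue) \<le> (c + 2) * (v - u)"
    proof (cases "?E' = {}")
      case True
      then have "?E = {}" by auto
      then show ?thesis
        using uv c0 by (simp del: Collect_empty_eq)
    next
      case False
      have "compact ?E'"
      proof -
        have "closed (\<Phi> -` {u..v})"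
          using cont by (intro closed_vimage) auto
        then have "compact ({0..R} \<inter> \<Phi> -` {u..v})"
          by (intro compact_Int_closed) auto
        also have "{0..R} \<inter> \<Phi> -` {u..v} = ?E'" by auto
        finally show ?thesis .
      qed
      from compact_attains_inf[OF this False] compact_attains_sup[OF this False]
      obtain a b where a: "a \<in> ?E'" "\<And>x. x \<in> ?E' \<Longrightarrow> a \<le> x" and b: "b \<in> ?E'" "\<And>x. x \<in> ?E' \<Longrightarrow> x \<le> b"
        by blast
      have ab: "0 \<le> a" "a \<le> b" using a b by auto
      have sub: "?E \<subseteq> {a..b}"
        using a(2) b(2) by fastforce
      have E_borel: "?E \<in> sets borel"
      proof -
        have [measurable]: "\<Phi> \<in> borel_measurable borel"
          using cont by (rule borel_measurable_continuous_onI)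
        show ?thesis by measurable
      qed
      then have E: "?E \<in> sets lebesgue" by simp
      have "(\<integral>x. h x * indicator ?E x \<partial>lebesgue) \<le> (\<integral>x. h x * indicator {a..b} x \<partial>lebesgue)"
        using h nonneg sub E
        by (intro integral_mono integrable_real_mult_indicator mult_left_mono) (auto simp: indicator_def)
      also have "\<dots> \<le> integral {a..b} ?h"
        unfolding h_int[symmetric] using ab R by (simp add: h1_eq)
      also have "\<dots> = (c + 2) * (G b - G a)"
        using diff[OF ab] c0 by simp
      also have "\<dots> \<le> (c + 2) * (v - u)"
        using a b c0 by (intro mult_left_mono) (auto simp: \<Phi>_eq)
      finally show ?thesis .
    qed
  qed
qed

text \<open>A product of integrals is an integral over the product space. At each point only one
  tuple survives the sum, namely the cells containing its coordinates.\<close>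

lemma ordered_sum_eq_integral:
  fixes g :: "'i \<Rightarrow> 'a \<Rightarrow> complex"
  assumes "finite J" "sigma_finite_measure M"
    and g: "\<And>i. i \<in> J \<Longrightarrow> integrable M (g i)"
    and N [measurable]: "N \<in> measurable M (count_space UNIV)"
    and less: "\<And>x. x \<in> space M \<Longrightarrow> N x < K"
  shows "ordered_sum A (\<lambda>i j. \<integral>x. g i x * of_bool (N x = j) \<partial>M) J {..<K} =
    (\<integral>x. of_bool (order_ok A J (\<lambda>i. N (x i))) * (\<Prod>i\<in>J. g i (x i)) \<partial>Pi\<^sub>M J (\<lambda>_. M))"
proof -
  interpret sigma_finite_measure M by fact
  interpret product_sigma_finite "\<lambda>_. M" by standard
  let ?P = "Pi\<^sub>E J (\<lambda>_. {..<K})"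
  let ?G = "\<lambda>v x. \<Prod>i\<in>J. g i (x i) * of_bool (N (x i) = v i)"
  have int1: "integrable M (\<lambda>x. g i x * of_bool (N x = j))" if "i \<in> J" for i j
  proof (rule Bochner_Integration.integrable_bound[OF g[OF that]])
    have [measurable]: "g i \<in> borel_measurable M" using g[OF that] by auto
    show "(\<lambda>x. g i x * of_bool (N x = j)) \<in> borel_measurable M" by measurable
  qed (auto simp: norm_mult)
  have int: "integrable (Pi\<^sub>M J (\<lambda>_. M)) (?G v)" for v
    using assms(1) int1 by (intro product_integrable_prod)
  have "ordered_sum A (\<lambda>i j. \<integral>x. g i x * of_bool (N x = j) \<partial>M) J {..<K} =
      (\<Sum>v\<in>?P. of_bool (order_ok A J v) * (\<integral>x. ?G v x \<partial>Pi\<^sub>M J (\<lambda>_. M)))"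
    unfolding ordered_sum_def using assms(1) int1
    by (intro sum.cong refl arg_cong2[where f = "(*)"] product_integral_prod[symmetric])
  also have "\<dots> = (\<integral>x. (\<Sum>v\<in>?P. of_bool (order_ok A J v) * ?G v x) \<partial>Pi\<^sub>M J (\<lambda>_. M))"
    using int by (subst Bochner_Integration.integral_sum) auto
  also have "\<dots> = (\<integral>x. of_bool (order_ok A J (\<lambda>i. N (x i))) * (\<Prod>i\<in>J. g i (x i)) \<partial>Pi\<^sub>M J (\<lambda>_. M))"
  proof (rule Bochner_Integration.integral_cong[OF refl])
    fix x assume x: "x \<in> space (Pi\<^sub>M J (\<lambda>_. M))"
    define v0 where "v0 = restrict (\<lambda>i. N (x i)) J"
    have v0: "v0 \<in> ?P"
      using x less by (auto simp: v0_def space_PiM PiE_iff)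
    have "(\<Sum>v\<in>?P. of_bool (order_ok A J v) * ?G v x) =
        (\<Sum>v\<in>{v0}. of_bool (order_ok A J v) * ?G v x)"
    proof (rule sum.mono_neutral_right)
      show "finite ?P" using assms(1) by (intro finite_PiE) auto
      show "{v0} \<subseteq> ?P" using v0 by simp
      show "\<forall>v\<in>?P - {v0}. of_bool (order_ok A J v) * ?G v x = 0"
      proof
        fix v assume v: "v \<in> ?P - {v0}"
        then have "\<exists>i\<in>J. v i \<noteq> v0 i" using v0 PiE_ext[of v J "\<lambda>_. {..<K}" v0] by blast
        then obtain i where "i \<in> J" "N (x i) \<noteq> v i" by (auto simp: v0_def)
        then have "?G v x = 0" using assms(1) by (intro prod_zero) auto
        then show "of_bool (order_ok A J v) * ?G v x = 0" by simp
      qed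
    qed
    also have "\<dots> = of_bool (order_ok A J (\<lambda>i. N (x i))) * (\<Prod>i\<in>J. g i (x i))"
    proof -
      have "order_ok A J v0 \<longleftrightarrow> order_ok A J (\<lambda>i. N (x i))"
        by (force simp: order_ok_def v0_def)
      moreover have "?G v0 x = (\<Prod>i\<in>J. g i (x i))"
        by (intro prod.cong refl) (simp add: v0_def)
      ultimately show ?thesis by simp
    qed
    finally show "(\<Sum>v\<in>?P. of_bool (order_ok A J v) * ?G v x) =
      of_bool (order_ok A J (\<lambda>i. N (x i))) * (\<Prod>i\<in>J. g i (x i))" .
  qed
  finally show ?thesis .
qed

section \<open>Dyadic approximation of the coordinate\<close>

definition dyadic_index :: "('a \<Rightarrow> real) \<Rightarrow> nat \<Rightarrow> 'a \<Rightarrow> nat" where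
  "dyadic_index \<Phi> m x = nat \<lfloor>2 ^ m * \<Phi> x\<rfloor>"

lemma measurable_dyadic_index [measurable]:
  assumes [measurable]: "\<Phi> \<in> borel_measurable M"
  shows "dyadic_index \<Phi> m \<in> measurable M (count_space UNIV)"
  unfolding dyadic_index_def by measurable

lemma dyadic_index_less:
  assumes "0 \<le> \<Phi> x" "\<Phi> x < 1" shows "dyadic_index \<Phi> m x < 2 ^ m"
proof -
  have "\<lfloor>2 ^ m * \<Phi> x\<rfloor> < 2 ^ m"
    using assms by (simp add: floor_less_iff)
  then show ?thesis
    unfolding dyadic_index_def by (simp add: nat_less_iff)
qed

text \<open>Identifies a block with a dyadic interval of length \<open>2 ^ d / 2 ^ m\<close> in the
  coordinate, so that the mass bound for \<Phi> applies to it.\<close>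

lemma dyadic_index_mem_block_iff:
  assumes "0 \<le> \<Phi> x"
  shows "dyadic_index \<Phi> m x \<in> block d j \<longleftrightarrow>
    real j * 2 ^ d / 2 ^ m \<le> \<Phi> x \<and> \<Phi> x < real (Suc j) * 2 ^ d / 2 ^ m"
proof -
  have 0: "0 \<le> 2 ^ m * \<Phi> x" using assms by simp
  have "dyadic_index \<Phi> m x \<in> block d j \<longleftrightarrow>
      real (j * 2 ^ d) \<le> 2 ^ m * \<Phi> x \<and> 2 ^ m * \<Phi> x < real (Suc j * 2 ^ d)"
    unfolding dyadic_index_def block_def atLeastLessThan_iff using 0
    by (simp add: le_nat_iff nat_less_iff le_floor_iff floor_less_iff del: of_nat_mult of_nat_Suc mult_Suc)
  then show ?thesis
    by (simp add: field_simps)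
qed

text \<open>Once \<open>2 ^ m\<close> times a positive gap reaches 1, the floors differ. Without
  such a gap, monotonicity of the floor rules out strict inequality for every
  \<open>m\<close>.\<close>

lemma eventually_dyadic_index_less_iff:
  assumes "0 \<le> \<Phi> x" "0 \<le> \<Phi> y"
  shows "\<forall>\<^sub>F m in sequentially. dyadic_index \<Phi> m x < dyadic_index \<Phi> m y \<longleftrightarrow> \<Phi> x < \<Phi> y"
proof (cases "\<Phi> x < \<Phi> y")
  case True
  obtain m0 where m0: "1 / (\<Phi> y - \<Phi> x) < 2 ^ m0"
    using real_arch_pow[of 2] by auto
  have "\<forall>\<^sub>F m in sequentially. 1 / (\<Phi> y - \<Phi> x) \<le> 2 ^ m"
    using eventually_ge_at_top[of m0]
  proof eventually_elim
    fix m assume "m0 \<le> m"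
    then have "(2::real) ^ m0 \<le> 2 ^ m" by (intro power_increasing) auto
    with m0 show "1 / (\<Phi> y - \<Phi> x) \<le> 2 ^ m" by linarith
  qed
  then show ?thesis
  proof eventually_elim
    fix m assume "1 / (\<Phi> y - \<Phi> x) \<le> (2::real) ^ m"
    then have "2 ^ m * \<Phi> x + 1 \<le> 2 ^ m * \<Phi> y"
      using True by (simp add: field_simps)
    then have "\<lfloor>2 ^ m * \<Phi> x\<rfloor> + 1 \<le> \<lfloor>2 ^ m * \<Phi> y\<rfloor>"
      by linarith
    moreover have "0 \<le> \<lfloor>2 ^ m * \<Phi> x\<rfloor>" using assms by simp
    ultimately have "nat \<lfloor>2 ^ m * \<Phi> x\<rfloor> < nat \<lfloor>2 ^ m * \<Phi> y\<rfloor>"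
      by linarith
    then show "dyadic_index \<Phi> m x < dyadic_index \<Phi> m y \<longleftrightarrow> \<Phi> x < \<Phi> y"
      using True by (simp add: dyadic_index_def)
  qed
next
  case False
  then have "dyadic_index \<Phi> m y \<le> dyadic_index \<Phi> m x" for m
    by (simp add: dyadic_index_def nat_mono floor_mono)
  then show ?thesis
    using False by (simp add: not_less)
qed

lemma ordered_sum_scale:
  "ordered_sum A (\<lambda>i m. c i * a i m) W S = (\<Prod>i\<in>W. c i) * ordered_sum A a W S"
  unfolding ordered_sum_def sum_distrib_left
  by (intro sum.cong refl) (simp add: prod.distrib mult_ac)

lemma borel_measurable_tree_sum [measurable]:
  assumes [measurable]: "\<And>i m. a i m \<in> borel_measurable M"
  shows "(\<lambda>x. tree_sum \<theta> r J (\<lambda>i m. a i m x) d j) \<in> borel_measurable M"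
  by (induction d arbitrary: j) simp_all

text \<open>The ratio \<open>2 * \<theta>\<^sup>2\<close> absorbs both the doubling of the number of blocks and the weight
  \<open>\<theta>\<close>, leaving a geometric series in \<open>1 / \<theta>\<close>.\<close>
lemma nn_integral_tree_sum_le:
  fixes a :: "'i \<Rightarrow> nat \<Rightarrow> 'a \<Rightarrow> complex" and \<theta> t e0 r :: real
  assumes "\<theta> > 1" "t \<ge> 1" "e0 > 0" "finite J" "J \<noteq> {}"
    and [measurable]: "\<And>i m. a i m \<in> borel_measurable M"
    and le: "\<And>i d j. i \<in> J \<Longrightarrow>
      (\<integral>\<^sup>+x. ennreal ((norm (\<Sum>m\<in>block d j. a i m x) powr r) powr t) \<partial>M)
        \<le> ennreal ((e0 * (2 * \<theta>\<^sup>2) ^ d) powr t)"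
  shows "(\<integral>\<^sup>+x. ennreal (tree_sum \<theta> r J (\<lambda>i m. a i m x) d j powr t) \<partial>M)
    \<le> ennreal ((card J * e0 * \<theta> / (\<theta> - 1) * (2 * \<theta>\<^sup>2) ^ d) powr t)"
proof (induction d arbitrary: j)
  case 0
  have "(\<integral>\<^sup>+x. ennreal (tree_sum \<theta> r J (\<lambda>i m. a i m x) 0 j powr t) \<partial>M)
      \<le> ennreal ((\<Sum>i\<in>J. e0) powr t)"
    unfolding tree_sum.simps using assms le[of _ 0 j] by (intro nn_integral_sum_powr_le) auto
  also have "\<dots> \<le> ennreal ((card J * e0 * \<theta> / (\<theta> - 1) * (2 * \<theta>\<^sup>2) ^ 0) powr t)"
    using assms by (intro ennreal_leI powr_mono2) (auto simp: field_simps)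
  finally show ?case .
next
  case (Suc d)
  let ?H = "card J * e0 * \<theta> / (\<theta> - 1)" and ?\<rho> = "2 * \<theta>\<^sup>2"
  \<comment> \<open>The root terms (\<open>Inl\<close>) and the two weighted subtrees
    (\<open>Inr\<close>) are listed as a single family, so that Minkowski's inequality is applied
    once.\<close>
  define y where "y e x = (case e of
       Inl i \<Rightarrow> norm (\<Sum>m\<in>block (Suc d) j. a i m x) powr r
     | Inr b \<Rightarrow> \<theta> * tree_sum \<theta> r J (\<lambda>i m. a i m x) d (2 * j + of_bool b))"
    for e :: "'i + bool" and x
  define K where "K = (\<lambda>e :: 'i + bool. case e of
       Inl i \<Rightarrow> e0 * ?\<rho> ^ Suc d | Inr b \<Rightarrow> \<theta> * (?H * ?\<rho> ^ d))"
  have H: "?H > 0"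
    using assms by (auto simp: card_gt_0_iff)
  have K: "K e > 0" for e
    unfolding K_def using assms(1,3) H by (cases e) (simp_all only: sum.case, (intro mult_pos_pos zero_less_power; simp)+)
  have "(\<integral>\<^sup>+x. ennreal ((\<Sum>e\<in>J <+> UNIV. y e x) powr t) \<partial>M)
      \<le> ennreal ((\<Sum>e\<in>J <+> UNIV. K e) powr t)"
  proof (rule nn_integral_sum_powr_le)
    fix e assume e: "e \<in> J <+> (UNIV :: bool set)"
    show "y e \<in> borel_measurable M"
      unfolding y_def by (cases e) simp_all
    show "y e x \<ge> 0" for x
      using assms by (cases e) (auto simp: y_def intro!: mult_nonneg_nonneg tree_sum_nonneg)
    show "(\<integral>\<^sup>+x. ennreal (y e x powr t) \<partial>M) \<le> ennreal (K e powr t)"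
    proof (cases e)
      case (Inl i)
      then show ?thesis using e le[of i "Suc d" j] by (auto simp: y_def K_def)
    next
      case (Inr b)
      have "(\<integral>\<^sup>+x. ennreal (y e x powr t) \<partial>M) = ennreal (\<theta> powr t) *
          (\<integral>\<^sup>+x. ennreal (tree_sum \<theta> r J (\<lambda>i m. a i m x) d (2 * j + of_bool b) powr t) \<partial>M)"
        using assms unfolding Inr y_def
        by (subst nn_integral_cmult[symmetric])
          (auto simp: powr_mult tree_sum_nonneg ennreal_mult)
      also have "\<dots> \<le> ennreal (\<theta> powr t) * ennreal ((?H * ?\<rho> ^ d) powr t)"
        by (intro mult_left_mono Suc.IH) auto
      also have "\<dots> = ennreal (K e powr t)"
      proof -
        have "(\<theta> * (?H * ?\<rho> ^ d)) powr t = \<theta> powr t * (?H * ?\<rho> ^ d) powr t"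
          by (rule powr_mult)
        then show ?thesis
          unfolding Inr K_def sum.case by (simp only: ennreal_mult[symmetric] powr_ge_zero)
      qed
      finally show ?thesis .
    qed
  qed (use assms K in auto)
  \<comment> \<open>\<open>?H\<close> solves this recursion exactly: the children contribute
    \<open>1 / \<theta>\<close> of the target and the root terms the remaining
    \<open>1 - 1 / \<theta>\<close>.\<close>
  also have "(\<Sum>e\<in>J <+> UNIV. K e) = ?H * ?\<rho> ^ Suc d"
  proof -
    have "(\<Sum>e\<in>J <+> UNIV. K e) = card J * e0 * ?\<rho> ^ Suc d + 2 * \<theta> * (?H * ?\<rho> ^ d)"
      using assms by (simp add: sum.Plus K_def UNIV_bool)
    also have "\<dots> = ?H * ?\<rho> ^ Suc d"
      using assms by (simp add: field_simps power2_eq_square)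
    finally show ?thesis .
  qed
  also have "(\<lambda>x. \<Sum>e\<in>J <+> UNIV. y e x) = (\<lambda>x. tree_sum \<theta> r J (\<lambda>i m. a i m x) (Suc d) j)"
    using assms by (intro ext) (simp add: sum.Plus y_def UNIV_bool distrib_left)
  finally show ?case .
qed

text \<open>For finite \<open>J\<close> this is a conjunction over a finite set of pairs, from which
  measurability and eventual stability follow.\<close>

lemma order_ok_iff: "order_ok A J v \<longleftrightarrow> (\<forall>z\<in>A \<inter> J \<times> J. v (snd z) < v (fst z))"
proof
  assume *: "\<forall>z\<in>A \<inter> J \<times> J. v (snd z) < v (fst z)"
  have "v i' < v i" if "(i, i') \<in> A" "i \<in> J" "i' \<in> J" for i i'
    using bspec[OF *, of "(i, i')"] that by simp
  then show "order_ok A J v"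
    unfolding order_ok_def by blast
qed (auto simp: order_ok_def)

text \<open>Dominated convergence: at each point the discrete constraint eventually agrees with the
  one in \<Phi>, and the unconstrained product is an integrable majorant.\<close>

lemma ordered_sum_dyadic_tendsto:
  fixes g :: "'i \<Rightarrow> 'a \<Rightarrow> complex" and \<Phi> :: "'a \<Rightarrow> real"
  assumes "finite J" "sigma_finite_measure M"
    and g: "\<And>i. i \<in> J \<Longrightarrow> integrable M (g i)"
    and \<Phi> [measurable]: "\<Phi> \<in> borel_measurable M" and \<Phi>0: "\<And>x. 0 \<le> \<Phi> x" and \<Phi>1: "\<And>x. \<Phi> x < 1"
  shows "(\<lambda>m. ordered_sum A (\<lambda>i j. \<integral>x. g i x * of_bool (dyadic_index \<Phi> m x = j) \<partial>M) J {..<2 ^ m})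
    \<longlonglongrightarrow> (\<integral>x. of_bool (order_ok A J (\<lambda>i. \<Phi> (x i))) * (\<Prod>i\<in>J. g i (x i)) \<partial>Pi\<^sub>M J (\<lambda>_. M))"
proof -
  interpret sigma_finite_measure M by fact
  interpret product_sigma_finite "\<lambda>_. M" by standard
  let ?N = "dyadic_index \<Phi>"
  let ?G = "\<lambda>x. \<Prod>i\<in>J. g i (x i)"
  have G: "integrable (Pi\<^sub>M J (\<lambda>_. M)) ?G"
    using assms(1) g by (rule product_integrable_prod)
  have fin: "finite (A \<inter> J \<times> J)"
    using assms(1) by simp
  have meas: "(\<lambda>x. of_bool (order_ok A J (\<lambda>i. v (x i))) * ?G x) \<in> borel_measurable (Pi\<^sub>M J (\<lambda>_. M))"
    if v: "v \<in> borel_measurable M" for v :: "'a \<Rightarrow> real"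
  proof -
    have [measurable]: "(\<lambda>x. v (x i)) \<in> borel_measurable (Pi\<^sub>M J (\<lambda>_. M))" if "i \<in> J" for i
      using that v by measurable
    have "Measurable.pred (Pi\<^sub>M J (\<lambda>_. M)) (\<lambda>x. \<forall>z\<in>A \<inter> J \<times> J. v (x (snd z)) < v (x (fst z)))"
      using fin by (intro pred_intros_finite) auto
    then have "Measurable.pred (Pi\<^sub>M J (\<lambda>_. M)) (\<lambda>x. order_ok A J (\<lambda>i. v (x i)))"
      unfolding order_ok_iff .
    then show ?thesis
      using G by (intro borel_measurable_times) auto
  qed
  have real_nat: "order_ok A J (\<lambda>i. real (v i)) = order_ok A J v" for v
    by (simp add: order_ok_def)
  have "(\<lambda>m. \<integral>x. of_bool (order_ok A J (\<lambda>i. ?N m (x i))) * ?G x \<partial>Pi\<^sub>M J (\<lambda>_. M))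
      \<longlonglongrightarrow> (\<integral>x. of_bool (order_ok A J (\<lambda>i. \<Phi> (x i))) * ?G x \<partial>Pi\<^sub>M J (\<lambda>_. M))"
  proof (rule integral_dominated_convergence[where w = "\<lambda>x. norm (?G x)"])
    show "(\<lambda>x. of_bool (order_ok A J (\<lambda>i. ?N m (x i))) * ?G x) \<in> borel_measurable (Pi\<^sub>M J (\<lambda>_. M))" for m
      using meas[of "\<lambda>x. real (?N m x)"] by (simp add: real_nat)
    show "AE x in Pi\<^sub>M J (\<lambda>_. M). (\<lambda>m. of_bool (order_ok A J (\<lambda>i. ?N m (x i))) * ?G x)
        \<longlonglongrightarrow> of_bool (order_ok A J (\<lambda>i. \<Phi> (x i))) * ?G x"
    proof (rule AE_I2)
      fix x
      have "\<forall>\<^sub>F m in sequentially. \<forall>z\<in>A \<inter> J \<times> J.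
          ?N m (x (snd z)) < ?N m (x (fst z)) \<longleftrightarrow> \<Phi> (x (snd z)) < \<Phi> (x (fst z))"
        by (intro eventually_ball_finite fin ballI eventually_dyadic_index_less_iff \<Phi>0)
      then have "\<forall>\<^sub>F m in sequentially. of_bool (order_ok A J (\<lambda>i. ?N m (x i))) * ?G x
          = of_bool (order_ok A J (\<lambda>i. \<Phi> (x i))) * ?G x"
        by eventually_elim (simp add: order_ok_iff)
      then show "(\<lambda>m. of_bool (order_ok A J (\<lambda>i. ?N m (x i))) * ?G x)
        \<longlonglongrightarrow> of_bool (order_ok A J (\<lambda>i. \<Phi> (x i))) * ?G x"
        by (rule tendsto_eventually)
    qed
  qed (use G meas[OF \<Phi>] in \<open>auto simp: norm_mult\<close>)
  moreover have "ordered_sum A (\<lambda>i j. \<integral>x. g i x * of_bool (?N m x = j) \<partial>M) J {..<2 ^ m} =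
      (\<integral>x. of_bool (order_ok A J (\<lambda>i. ?N m (x i))) * ?G x \<partial>Pi\<^sub>M J (\<lambda>_. M))" for m
  proof (rule ordered_sum_eq_integral[OF assms(1,2) g])
    show "?N m x < 2 ^ m" for x
      by (intro dyadic_index_less \<Phi>0 \<Phi>1)
  qed auto
  ultimately show ?thesis by simp
qed

text \<open>Finiteness of \<open>A\<close> matters: a violated constraint must annihilate the
  product, whereas a product over an infinite set would be 1 by convention.\<close>

lemma prod_indicator_eq_order_ok:
  fixes x :: "'i \<Rightarrow> real"
  assumes "finite J" "A \<subseteq> J \<times> J"
  shows "(\<Prod>(i, i')\<in>A. indicator {0<..} (x i - x i')) = (of_bool (order_ok A J x) :: complex)"
proof (cases "order_ok A J x")
  case True
  then show ?thesis
    using assms(2) by (auto simp: order_ok_def indicator_def intro!: prod.neutral)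
next
  case False
  then obtain i i' where "(i, i') \<in> A" "\<not> x i' < x i"
    by (auto simp: order_ok_def)
  then have "\<exists>z\<in>A. (case z of (i, i') \<Rightarrow> indicator {0<..} (x i - x i')) = (0 :: complex)"
    by (intro bexI[of _ "(i, i')"]) auto
  moreover have "finite A"
    using assms finite_subset by blast
  ultimately show ?thesis
    using False by simp
qed

lemma sigma_finite_measure_Rplus: "sigma_finite_measure Rplus"
proof (rule sigma_finite_measure_restrict_space)
  from lborel.sigma_finite_countable obtain A :: "real set set" where
    A: "countable A \<and> A \<subseteq> sets lborel \<and> \<Union>A = space lborel \<and> (\<forall>a\<in>A. emeasure lborel a \<noteq> \<infinity>)" ..
  show "sigma_finite_measure (lebesgue :: real measure)"
  proof
    have "A \<subseteq> sets lebesgue"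
      using A sets_completionI_sets[of _ lborel] by (metis subset_iff)
    moreover have "\<forall>a\<in>A. emeasure lebesgue a \<noteq> \<infinity>"
    proof
      fix a assume "a \<in> A"
      with A have "a \<in> sets lborel" "emeasure lborel a \<noteq> \<infinity>" by (meson subsetD)+
      then show "emeasure lebesgue a \<noteq> \<infinity>" by simp
    qed
    ultimately show "\<exists>A. countable A \<and> A \<subseteq> sets lebesgue \<and> \<Union>A = space (lebesgue :: real measure) \<and>
        (\<forall>a\<in>A. emeasure lebesgue a \<noteq> \<infinity>)"
      using A by (intro exI[of _ A] conjI) simp_all
  qed
qed simp

subsection \<open>The multilinear bound\<close>

text \<open>The index \<open>r = min q 2\<close> lies in \<open>(p, 2]\<close>: \<open>r > p\<close> makes the dyadic sums converge,
  \<open>r \<le> 2\<close> lets pairs of sibling blocks be summed.\<close>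
lemma multi_op_bound_bounded_support:
  fixes n :: nat and p q r s \<theta> D e R :: real
  defines "r \<equiv> min q 2" and "\<theta> \<equiv> 2 powr ((r / p - 1) / 2)"
  assumes n: "n \<ge> 2" and p: "1 \<le> p" "p < 2" and q: "q > p" and s: "s = q / n" and D: "D > 0"
    and I: "I \<in> sets lebesgue"
    and k: "\<And>i. i \<in> {1..n} \<Longrightarrow> kernel_bounded p q I (k i) D"
    and A: "A \<subseteq> {1..n} \<times> {1..n}"
    and f: "\<And>i. i \<in> {1..n} \<Longrightarrow> in_Lp p Rplus (f i)"
    and F: "\<And>i. F i > 0" "\<And>i. i \<in> {1..n} \<Longrightarrow> Lp_norm p Rplus (f i) \<le> F i"
    and eR: "0 < e" "e \<le> R" and supp: "\<And>i x. i \<in> {1..n} \<Longrightarrow> x > 0 \<Longrightarrow> x \<notin> {e..R} \<Longrightarrow> f i x = 0"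
  shows "multi_op n A k f \<in> borel_measurable (lebesgue_on I)" (is ?meas)
    and "(\<integral>\<^sup>+l. ennreal (norm (multi_op n A k f l) powr s) \<partial>lebesgue_on I) \<le>
      ennreal ((tree_const \<theta> n * (n * (D powr r * (n + 2) powr (r / p)) * \<theta> / (\<theta> - 1)) powr (n / r) *
        (\<Prod>i\<in>{1..n}. F i)) powr s)" (is ?bound)
proof -
  let ?J = "{1..n}"
  define t where "t = q / r"
  have r: "p < r" "r \<le> 2" "r \<le> q" "0 < r" using p q by (auto simp: r_def)
  have t: "t \<ge> 1" using r by (simp add: t_def)
  have s0: "s > 0" using n p q by (simp add: s)
  have rp: "r / p > 1" using r p by simp
  have \<theta>: "\<theta> > 1" unfolding \<theta>_def using rp by simp
  \<comment> \<open>\<theta> is chosen so that the ratio of the tree estimate equals the gain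
    \<open>2 powr (r / p)\<close> of the kernel bound per generation.\<close>
  have \<theta>2: "2 * \<theta>\<^sup>2 = 2 powr (r / p)"
  proof -
    have "\<theta>\<^sup>2 = 2 powr (r / p - 1)"
      unfolding \<theta>_def by (simp add: power2_eq_square flip: powr_add)
    then show ?thesis by (simp add: powr_diff)
  qed
  have J: "finite ?J" "?J \<noteq> {}" using n by auto
  interpret Rp: sigma_finite_measure Rplus by (rule sigma_finite_measure_Rplus)

  have fp: "integrable lebesgue (\<lambda>x. indicator {0<..} x * norm (f i x) powr p)" if "i \<in> ?J" for i
    using f[OF that] unfolding in_Lp_def by (subst (asm) integrable_restrict_space) auto
  have fF: "(\<integral>x. norm (f i x) powr p \<partial>Rplus) \<le> F i powr p" if "i \<in> ?J" for i
  proof -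
    let ?X = "\<integral>x. norm (f i x) powr p \<partial>Rplus"
    have "?X = (?X powr (1 / p)) powr p"
      using p by (simp add: powr_powr)
    also have "\<dots> \<le> F i powr p"
      using F(2)[OF that] p unfolding Lp_norm_def by (intro powr_mono2) auto
    finally show ?thesis .
  qed
  have Rp_int: "(\<integral>x. g x \<partial>Rplus) = (\<integral>x. indicator {0<..} x * g x \<partial>lebesgue)" for g :: "real \<Rightarrow> real"
    by (subst integral_restrict_space) auto
  \<comment> \<open>Dividing by \<open>F i powr p\<close> gives every function mass at most 1, hence
    total mass at most \<open>n\<close>; one coordinate then serves all indices.\<close>
  define h where "h x = (\<Sum>i\<in>?J. indicator {0<..} x * norm (f i x) powr p / F i powr p)" for x
  have h_int: "integrable lebesgue h"
    unfolding h_def using fp by (intro Bochner_Integration.integrable_sum integrable_divide_zero) auto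
  have h_nonneg: "h x \<ge> 0" for x
    unfolding h_def by (intro sum_nonneg) auto
  have h_le: "(\<integral>x. h x \<partial>lebesgue) \<le> n"
  proof -
    have "(\<integral>x. h x \<partial>lebesgue) = (\<Sum>i\<in>?J. (\<integral>x. norm (f i x) powr p \<partial>Rplus) / F i powr p)"
      unfolding h_def Rp_int using fp by (subst Bochner_Integration.integral_sum) auto
    also have "\<dots> \<le> (\<Sum>i\<in>?J. 1)"
      using fF F(1) by (intro sum_mono) (simp add: divide_le_eq_1)
    finally show ?thesis by simp
  qed
  have "R > 0" using eR by simp
  from mass_coordinate[OF h_int h_nonneg h_le this] obtain \<Phi> where
    \<Phi>_cont: "continuous_on UNIV \<Phi>" and \<Phi>0: "\<And>x. 0 \<le> \<Phi> x" and \<Phi>1: "\<And>x. \<Phi> x < 1"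
    and \<Phi>_mono: "strict_mono_on {0..R} \<Phi>" and mass: "\<And>u v. u \<le> v \<Longrightarrow>
       (\<integral>x. h x * indicator {x\<in>{0..R}. u \<le> \<Phi> x \<and> \<Phi> x < v} x \<partial>lebesgue) \<le> (real n + 2) * (v - u)"
    by blast
  have \<Phi>_borel [measurable]: "\<Phi> \<in> borel_measurable borel"
    using \<Phi>_cont by (rule borel_measurable_continuous_onI)
  have \<Phi>_leb [measurable]: "\<Phi> \<in> borel_measurable lebesgue"
    using measurable_completion[of \<Phi> lborel borel] by simp
  have \<Phi>_Rp [measurable]: "\<Phi> \<in> borel_measurable Rplus"
    by (rule measurable_restrict_space1) simp
  let ?N = "dyadic_index \<Phi>"
  define fb where "fb m d j i x = f i x * of_bool (?N m x \<in> block d j)" for m d j i x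
  have f_meas [measurable]: "f i \<in> borel_measurable Rplus" if "i \<in> ?J" for i
    using f[OF that] by (simp add: in_Lp_def)
  have fb_meas: "fb m d j i \<in> borel_measurable Rplus" if "i \<in> ?J" for m d j i
    using f_meas[OF that] unfolding fb_def by measurable
  have fb_Lp: "in_Lp p Rplus (fb m d j i)" if "i \<in> ?J" for m d j i
    unfolding in_Lp_def
  proof (intro conjI fb_meas[OF that])
    have "integrable Rplus (\<lambda>x. norm (f i x) powr p)"
      using f[OF that] by (simp add: in_Lp_def)
    then show "integrable Rplus (\<lambda>x. norm (fb m d j i x) powr p)"
    proof (rule Bochner_Integration.integrable_bound)
      show "(\<lambda>x. norm (fb m d j i x) powr p) \<in> borel_measurable Rplus"
        using fb_meas[OF that] by measurable
    qed (auto simp: fb_def)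
  qed
  have compact_supp: "compactly_supported g" if "i \<in> ?J" "\<And>x. f i x = 0 \<Longrightarrow> g x = 0" for i g
    unfolding compactly_supported_def using eR supp[OF that(1)] that(2)
    by (intro exI[of _ "{e..R}"]) auto
  have fb_supp: "compactly_supported (fb m d j i)" if "i \<in> ?J" for m d j i
    by (rule compact_supp[OF that]) (simp add: fb_def)
  \<comment> \<open>Up to the normalization, \<open>f i\<close> raised to the power \<open>p\<close>
    is dominated by \<open>h\<close>, whose mass on a block is controlled by the block's length in
    \<Phi>.\<close>
  have fb_mass: "(\<integral>x. norm (fb m d j i x) powr p \<partial>Rplus) \<le> F i powr p * ((real n + 2) * (2 ^ d / 2 ^ m))"
    if i: "i \<in> ?J" for m d j i
  proof -
    let ?u = "real j * 2 ^ d / 2 ^ m" and ?v = "real (Suc j) * 2 ^ d / 2 ^ m"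
    let ?E = "{x\<in>{0..R}. ?u \<le> \<Phi> x \<and> \<Phi> x < ?v}"
    have E: "?E \<in> sets lebesgue"
    proof -
      have "?E \<in> sets borel" by measurable
      then show ?thesis by simp
    qed
    have "indicator {0<..} x * norm (fb m d j i x) powr p \<le> F i powr p * (h x * indicator ?E x)" for x
    proof (cases "x > 0 \<and> fb m d j i x \<noteq> 0")
      case True
      then have "x \<in> {e..R}" and N: "?N m x \<in> block d j" and x: "x > 0"
        using supp[OF i] by (auto simp: fb_def)
      moreover have "?u \<le> \<Phi> x \<and> \<Phi> x < ?v"
        using dyadic_index_mem_block_iff[of \<Phi> x m d j] \<Phi>0 N by blast
      ultimately have xE: "x \<in> ?E" by auto
      have "norm (f i x) powr p / F i powr p \<le> h x"
        unfolding h_def using i x member_le_sum[of i ?J "\<lambda>i. indicator {0<..} x * norm (f i x) powr p / F i powr p"]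
        by simp
      then show ?thesis
        using xE x N F(1)[of i] by (simp add: fb_def field_simps)
    next
      case False
      then show ?thesis
        using h_nonneg[of x] by (auto intro!: mult_nonneg_nonneg)
    qed
    moreover have "integrable lebesgue (\<lambda>x. indicator {0<..} x * norm (fb m d j i x) powr p)"
      using fb_Lp[OF i] unfolding in_Lp_def by (subst (asm) integrable_restrict_space) auto
    moreover have "integrable lebesgue (\<lambda>x. h x * indicator ?E x)"
      using h_int E by (intro integrable_real_mult_indicator)
    ultimately have "(\<integral>x. norm (fb m d j i x) powr p \<partial>Rplus) \<le> (\<integral>x. F i powr p * (h x * indicator ?E x) \<partial>lebesgue)"
      unfolding Rp_int by (intro integral_mono) auto
    also have "\<dots> \<le> F i powr p * ((real n + 2) * (?v - ?u))"
      by (simp only: integral_mult_right_zero, intro mult_left_mono mass) (auto simp: field_simps)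
    also have "?v - ?u = 2 ^ d / 2 ^ m"
      by (simp add: field_simps)
    finally show ?thesis .
  qed
  have K_Lp: "in_Lp q (lebesgue_on I) (kernel_op (k i) (fb m d j i))" if "i \<in> ?J" for m d j i
    using k[OF that] fb_Lp[OF that] fb_supp[OF that] unfolding kernel_bounded_def by blast
  have K_le: "(\<integral>\<^sup>+l. ennreal (norm (kernel_op (k i) (fb m d j i) l) powr q) \<partial>lebesgue_on I)
      \<le> ennreal ((D * F i) powr q * ((real n + 2) * (2 ^ d / 2 ^ m)) powr (q / p))"
    if i: "i \<in> ?J" for m d j i
  proof -
    let ?X = "\<integral>l. norm (kernel_op (k i) (fb m d j i) l) powr q \<partial>lebesgue_on I"
    let ?Y = "(real n + 2) * (2 ^ d / 2 ^ m)"
    have "Lp_norm q (lebesgue_on I) (kernel_op (k i) (fb m d j i)) \<le> D * Lp_norm p Rplus (fb m d j i)"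
      using k[OF i] fb_Lp[OF i] fb_supp[OF i] unfolding kernel_bounded_def by blast
    also have "\<dots> \<le> D * (F i powr p * ?Y) powr (1 / p)"
      unfolding Lp_norm_def using D p fb_mass[OF i] by (intro mult_left_mono powr_mono2) auto
    also have "\<dots> = D * F i * ?Y powr (1 / p)"
      using F(1)[of i] p by (subst powr_mult) (auto simp: powr_powr)
    finally have "?X powr (1 / q) \<le> D * F i * ?Y powr (1 / p)"
      by (simp add: Lp_norm_def)
    then have "(?X powr (1 / q)) powr q \<le> (D * F i * ?Y powr (1 / p)) powr q"
      using p q by (intro powr_mono2) auto
    then have "?X \<le> (D * F i) powr q * ?Y powr (q / p)"
      using D F(1)[of i] p q by (simp add: powr_powr powr_mult)
    moreover have "(\<integral>\<^sup>+l. ennreal (norm (kernel_op (k i) (fb m d j i) l) powr q) \<partial>lebesgue_on I) = ennreal ?X"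
      using K_Lp[OF i] unfolding in_Lp_def by (intro nn_integral_eq_integral) auto
    ultimately show ?thesis by (simp add: ennreal_leI)
  qed
  \<comment> \<open>The truncated \<open>f i\<close> are themselves admissible test functions, so
    their kernel integrals converge absolutely for almost every \<open>l\<close>.\<close>
  have good: "AE l in lebesgue_on I. \<forall>i\<in>?J. integrable Rplus (\<lambda>x. k i l x * f i x)"
    using k f compact_supp unfolding kernel_bounded_def by (intro AE_finite_allI) auto

  \<comment> \<open>The leaf values. Extension by 0 outside \<open>?J\<close> makes
    \<open>b m i j\<close> measurable for every \<open>i\<close>.\<close>
  define b where "b m i j = (if i \<in> ?J then kernel_op (k i) (fb m 0 j i) else (\<lambda>_. 0))" for m i j
  have b_meas [measurable]: "b m i j \<in> borel_measurable (lebesgue_on I)" for m i j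
    using K_Lp by (auto simp: b_def in_Lp_def)
  have b_block: "AE l in lebesgue_on I. \<forall>i\<in>?J. (\<Sum>j'\<in>block d j. b m i j' l) = kernel_op (k i) (fb m d j i) l"
    for m d j
    using good
  proof eventually_elim
    fix l assume l: "\<forall>i\<in>?J. integrable Rplus (\<lambda>x. k i l x * f i x)"
    show "\<forall>i\<in>?J. (\<Sum>j'\<in>block d j. b m i j' l) = kernel_op (k i) (fb m d j i) l"
    proof
      fix i assume i: "i \<in> ?J"
      have int: "integrable Rplus (\<lambda>x. k i l x * fb m 0 j' i x)" for j'
      proof (rule Bochner_Integration.integrable_bound)
        show "integrable Rplus (\<lambda>x. k i l x * f i x)" using l i by blast
        then have [measurable]: "(\<lambda>x. k i l x * f i x) \<in> borel_measurable Rplus" by auto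
        have "(\<lambda>x. (k i l x * f i x) * of_bool (?N m x \<in> block 0 j')) \<in> borel_measurable Rplus"
          by measurable
        then show "(\<lambda>x. k i l x * fb m 0 j' i x) \<in> borel_measurable Rplus"
          by (simp only: fb_def mult.assoc)
      qed (auto simp: fb_def norm_mult)
      have "(\<Sum>j'\<in>block d j. b m i j' l) = (\<integral>x. (\<Sum>j'\<in>block d j. k i l x * fb m 0 j' i x) \<partial>Rplus)"
        using i int by (subst Bochner_Integration.integral_sum) (auto simp: b_def kernel_op_def)
      also have "\<dots> = kernel_op (k i) (fb m d j i) l"
        unfolding kernel_op_def
      proof (rule Bochner_Integration.integral_cong[OF refl])
        fix x
        have "(\<Sum>j'\<in>block d j. of_bool (?N m x = j')) = (of_bool (?N m x \<in> block d j) :: complex)"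
          by (simp add: of_bool_def)
        then show "(\<Sum>j'\<in>block d j. k i l x * fb m 0 j' i x) = k i l x * fb m d j i x"
          by (simp add: fb_def flip: sum_distrib_left)
      qed
      finally show "(\<Sum>j'\<in>block d j. b m i j' l) = kernel_op (k i) (fb m d j i) l" .
    qed
  qed

  \<comment> \<open>This is the approximation \<open>S\<^sub>M\<close> of the overview;
    \<open>block m 0\<close> consists of all \<open>2 ^ m\<close> cells.\<close>
  define P where "P m l = ordered_sum A (\<lambda>i j. b m i j l) ?J (block m 0)" for m l
  have P_meas: "P m \<in> borel_measurable (lebesgue_on I)" for m
    unfolding P_def ordered_sum_def by measurable
  have P_lim: "AE l in lebesgue_on I. (\<lambda>m. P m l) \<longlonglongrightarrow> multi_op n A k f l"
    using good
  proof eventually_elim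
    fix l assume l: "\<forall>i\<in>?J. integrable Rplus (\<lambda>x. k i l x * f i x)"
    let ?g = "\<lambda>i x. k i l x * f i x"
    have "(\<lambda>m. ordered_sum A (\<lambda>i j. \<integral>x. ?g i x * of_bool (dyadic_index \<Phi> m x = j) \<partial>Rplus) ?J {..<2 ^ m})
      \<longlonglongrightarrow> (\<integral>x. of_bool (order_ok A ?J (\<lambda>i. \<Phi> (x i))) * (\<Prod>i\<in>?J. ?g i (x i)) \<partial>Rplus_power n)"
      using l by (intro ordered_sum_dyadic_tendsto J sigma_finite_measure_Rplus \<Phi>_Rp \<Phi>0 \<Phi>1) auto
    also have "(\<lambda>m. ordered_sum A (\<lambda>i j. \<integral>x. ?g i x * of_bool (dyadic_index \<Phi> m x = j) \<partial>Rplus) ?J {..<2 ^ m})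
        = (\<lambda>m. P m l)"
    proof
      fix m
      have "block m 0 = {..<2 ^ m}" by (auto simp: block_def)
      then show "ordered_sum A (\<lambda>i j. \<integral>x. ?g i x * of_bool (dyadic_index \<Phi> m x = j) \<partial>Rplus) ?J {..<2 ^ m} = P m l"
        unfolding P_def ordered_sum_def
        by (intro sum.cong arg_cong2[where f = "(*)"] prod.cong refl)
          (auto simp: b_def kernel_op_def fb_def mult.assoc)
    qed
    also have "(\<integral>x. of_bool (order_ok A ?J (\<lambda>i. \<Phi> (x i))) * (\<Prod>i\<in>?J. ?g i (x i)) \<partial>Rplus_power n)
        = multi_op n A k f l"
      unfolding multi_op_def
    proof (rule Bochner_Integration.integral_cong[OF refl])
      fix x assume "x \<in> space (Rplus_power n)"
      then have x: "x i > 0" if "i \<in> ?J" for i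
        using that by (auto simp: space_PiM PiE_iff)
      show "of_bool (order_ok A ?J (\<lambda>i. \<Phi> (x i))) * (\<Prod>i\<in>?J. ?g i (x i)) = multi_integrand n A k f l x"
      \<comment> \<open>\<Phi> reflects the order only on \<open>{0..R}\<close>; if a coordinate
        leaves the support, both integrands vanish.\<close>
      proof (cases "\<forall>i\<in>?J. x i \<in> {e..R}")
        case True
        have x0R: "x i \<in> {0..R}" if "i \<in> ?J" for i
          using bspec[OF True that] eR by simp
        have "\<Phi> (x i') < \<Phi> (x i) \<longleftrightarrow> x i' < x i" if "i \<in> ?J" "i' \<in> ?J" for i i'
          using x0R that by (intro strict_mono_on_less[OF \<Phi>_mono]) blast+
        then have "order_ok A ?J (\<lambda>i. \<Phi> (x i)) \<longleftrightarrow> order_ok A ?J x"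
          unfolding order_ok_def by blast
        then show ?thesis
          unfolding multi_integrand_def prod_indicator_eq_order_ok[OF J(1) A] by (simp add: mult.commute)
      next
        case False
        then obtain i where i: "i \<in> ?J" "x i \<notin> {e..R}" by blast
        then have "f i (x i) = 0" using supp x by blast
        then have "(\<Prod>i\<in>?J. ?g i (x i)) = 0" "(\<Prod>j\<in>?J. f j (x j) * k j l (x j)) = 0"
          using i by (auto intro!: prod_zero)
        then show ?thesis
          by (simp only: multi_integrand_def mult_zero_left mult_zero_right)
      qed
    qed
    finally show "(\<lambda>m. P m l) \<longlonglongrightarrow> multi_op n A k f l" .
  qed

  let ?e0 = "D powr r * (n + 2) powr (r / p)"
  let ?L = "n * ?e0 * \<theta> / (\<theta> - 1)"
  let ?F = "\<Prod>i\<in>?J. F i"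
  have e0: "?e0 > 0" using D by simp
  have L: "?L > 0" using n \<theta> e0 by simp
  have F0: "?F > 0" using F(1) by (intro prod_pos) auto
  have P_le: "(\<integral>\<^sup>+l. ennreal (norm (P m l) powr s) \<partial>lebesgue_on I)
      \<le> ennreal ((tree_const \<theta> n * ?L powr (n / r) * ?F) powr s)" for m
  proof -
    \<comment> \<open>Normalization makes the block bounds independent of \<open>i\<close>; the
      factors \<open>F i\<close> return through \<open>ordered_sum_scale\<close>.\<close>
    define a where "a i j l = complex_of_real (1 / F i) * b m i j l" for i j l
    have a_meas [measurable]: "a i j \<in> borel_measurable (lebesgue_on I)" for i j
      unfolding a_def by measurable
    let ?T = "\<lambda>l. tree_sum \<theta> r ?J (\<lambda>i j. a i j l) m 0"
    have "(\<integral>\<^sup>+l. ennreal (?T l powr t) \<partial>lebesgue_on I)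
        \<le> ennreal ((card ?J * (?e0 / 2 powr (m * (r / p))) * \<theta> / (\<theta> - 1) * (2 * \<theta>\<^sup>2) ^ m) powr t)"
    proof (rule nn_integral_tree_sum_le)
      fix i d j assume i: "i \<in> ?J"
      have "(\<integral>\<^sup>+l. ennreal ((norm (\<Sum>j'\<in>block d j. a i j' l) powr r) powr t) \<partial>lebesgue_on I) =
          (\<integral>\<^sup>+l. ennreal (1 / F i powr q) * ennreal (norm (kernel_op (k i) (fb m d j i) l) powr q) \<partial>lebesgue_on I)"
      proof (rule nn_integral_cong_AE)
        show "AE l in lebesgue_on I. ennreal ((norm (\<Sum>j'\<in>block d j. a i j' l) powr r) powr t) =
           ennreal (1 / F i powr q) * ennreal (norm (kernel_op (k i) (fb m d j i) l) powr q)"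
          using b_block[where m = m and d = d and j = j]
        proof eventually_elim
          fix l assume "\<forall>i\<in>?J. (\<Sum>j'\<in>block d j. b m i j' l) = kernel_op (k i) (fb m d j i) l"
          then have "(\<Sum>j'\<in>block d j. a i j' l) = complex_of_real (1 / F i) * kernel_op (k i) (fb m d j i) l"
            using i unfolding a_def sum_distrib_left[symmetric] by simp
          then show "ennreal ((norm (\<Sum>j'\<in>block d j. a i j' l) powr r) powr t) =
             ennreal (1 / F i powr q) * ennreal (norm (kernel_op (k i) (fb m d j i) l) powr q)"
            using F(1)[of i] r
            by (simp add: norm_mult norm_divide powr_powr t_def powr_divide flip: ennreal_mult)
        qed
      qed
      also have "\<dots> = ennreal (1 / F i powr q) *
          (\<integral>\<^sup>+l. ennreal (norm (kernel_op (k i) (fb m d j i) l) powr q) \<partial>lebesgue_on I)"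
        using K_Lp[OF i] unfolding in_Lp_def by (intro nn_integral_cmult) auto
      also have "\<dots> \<le> ennreal (1 / F i powr q) *
          ennreal ((D * F i) powr q * ((real n + 2) * (2 ^ d / 2 ^ m)) powr (q / p))"
        by (intro mult_left_mono K_le i) auto
      also have "\<dots> = ennreal (D powr q * ((real n + 2) * (2 ^ d / 2 ^ m)) powr (q / p))"
        using F(1)[of i] D by (simp add: powr_mult flip: ennreal_mult)
      \<comment> \<open>With \<open>r * t = q\<close> the kernel bound takes the geometric form in
        \<open>d\<close> required by the tree estimate.\<close>
      also have "D powr q * ((real n + 2) * (2 ^ d / 2 ^ m)) powr (q / p) =
          (?e0 / 2 powr (m * (r / p)) * (2 * \<theta>\<^sup>2) ^ d) powr t"
      proof -
        have rt: "r * t = q" "r / p * t = q / p"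
          using r by (simp_all add: t_def)
        have two: "(2 ^ c) powr x = 2 powr (real c * x)" for c :: nat and x :: real
          using powr_powr[of 2 "real c" x] by (simp add: powr_realpow)
        have "?e0 / 2 powr (m * (r / p)) * (2 * \<theta>\<^sup>2) ^ d =
            D powr r * ((real n + 2) * (2 ^ d / 2 ^ m)) powr (r / p)"
          unfolding \<theta>2 by (simp add: powr_mult powr_divide two powr_power add.commute)
        then show ?thesis
          by (simp only: powr_mult powr_powr rt)
      qed
      finally show "(\<integral>\<^sup>+l. ennreal ((norm (\<Sum>j'\<in>block d j. a i j' l) powr r) powr t) \<partial>lebesgue_on I)
        \<le> ennreal ((?e0 / 2 powr (m * (r / p)) * (2 * \<theta>\<^sup>2) ^ d) powr t)" .
    qed (use \<theta> t e0 J in auto)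
    \<comment> \<open>At the root the growth \<open>(2 * \<theta>\<^sup>2) ^ m\<close> cancels the
      smallness of the leaves, so the bound no longer depends on \<open>m\<close>.\<close>
    also have "card ?J * (?e0 / 2 powr (m * (r / p))) * \<theta> / (\<theta> - 1) * (2 * \<theta>\<^sup>2) ^ m = ?L"
      unfolding \<theta>2 using p by (simp add: powr_power)
    finally have T: "(\<integral>\<^sup>+l. ennreal (?T l powr t) \<partial>lebesgue_on I) \<le> ennreal (?L powr t)" .
    let ?c = "(tree_const \<theta> n * ?F) powr s"
    have "norm (P m l) powr s \<le> ?c * ?T l powr t" for l
    proof -
      have "P m l = ordered_sum A (\<lambda>i j. complex_of_real (F i) * a i j l) ?J (block m 0)"
        unfolding P_def a_def using F(1) by (simp add: less_imp_neq[symmetric] flip: of_real_mult mult.assoc)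
      then have "norm (P m l) = ?F * norm (ordered_sum A (\<lambda>i j. a i j l) ?J (block m 0))"
        using F0 by (simp add: ordered_sum_scale norm_mult flip: of_real_prod)
      also have "\<dots> \<le> ?F * (tree_const \<theta> (card ?J) * ?T l powr (card ?J / r))"
        using F0 J \<theta> r by (intro mult_left_mono norm_ordered_sum_le_tree_sum) auto
      finally have "norm (P m l) powr s \<le> (tree_const \<theta> n * ?F * ?T l powr (n / r)) powr s"
        using s0 by (intro powr_mono2) (auto simp: mult_ac)
      also have "\<dots> = ?c * (?T l powr (n / r)) powr s"
        by (rule powr_mult)
      \<comment> \<open>Here the exponent \<open>s = q / n\<close> is decisive:
        \<open>(n / r) * s = q / r = t\<close>.\<close>
      also have "(?T l powr (n / r)) powr s = ?T l powr t"
        using n by (simp add: powr_powr s t_def)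
      finally show ?thesis .
    qed
    then have "(\<integral>\<^sup>+l. ennreal (norm (P m l) powr s) \<partial>lebesgue_on I)
        \<le> (\<integral>\<^sup>+l. ennreal ?c * ennreal (?T l powr t) \<partial>lebesgue_on I)"
      by (intro nn_integral_mono) (auto simp flip: ennreal_mult intro!: ennreal_leI)
    also have "\<dots> = ennreal ?c * (\<integral>\<^sup>+l. ennreal (?T l powr t) \<partial>lebesgue_on I)"
      by (intro nn_integral_cmult) measurable
    also have "\<dots> \<le> ennreal ?c * ennreal (?L powr t)"
      by (intro mult_left_mono T) auto
    also have "\<dots> = ennreal ((tree_const \<theta> n * ?L powr (n / r) * ?F) powr s)"
    proof -
      have "?L powr t = (?L powr (n / r)) powr s"
        using n by (simp add: powr_powr s t_def)
      then show ?thesis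
        using F0 L tree_const_ge_1[OF \<theta>, of n]
        by (subst ennreal_mult[symmetric]) (simp_all add: powr_mult mult_ac)
    qed
    finally show ?thesis .
  qed
  from powr_norm_limit_le[OF complete_measure_lebesgue_on[OF I] s0 P_meas P_lim P_le]
  show ?meas ?bound by blast+
qed

section \<open>Common constants, truncation and the general case\<close>

lemma kernel_bounded_mono:
  assumes "kernel_bounded p q I k C" "C \<le> C'"
  shows "kernel_bounded p q I k C'"
proof -
  have "C * Lp_norm p Rplus f \<le> C' * Lp_norm p Rplus f" for f
    using assms(2) by (intro mult_right_mono) (auto simp: Lp_norm_def)
  with assms(1) show ?thesis
    unfolding kernel_bounded_def by (meson order_trans)
qed

lemma in_Lp_restrict:
  assumes f: "in_Lp p M f" and B: "Measurable.pred M B"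
  shows "in_Lp p M (\<lambda>x. f x * of_bool (B x))"
    and "0 < p \<Longrightarrow> Lp_norm p M (\<lambda>x. f x * of_bool (B x)) \<le> Lp_norm p M f"
proof -
  have [measurable]: "f \<in> borel_measurable M" and int: "integrable M (\<lambda>x. norm (f x) powr p)"
    using f by (auto simp: in_Lp_def)
  note B [measurable]
  have int': "integrable M (\<lambda>x. norm (f x * of_bool (B x)) powr p)"
    using int by (rule Bochner_Integration.integrable_bound) auto
  then show "in_Lp p M (\<lambda>x. f x * of_bool (B x))"
    unfolding in_Lp_def by simp
  show "Lp_norm p M (\<lambda>x. f x * of_bool (B x)) \<le> Lp_norm p M f" if "0 < p"
    unfolding Lp_norm_def using int int' that
    by (intro powr_mono2 integral_mono) auto
qed

text \<open>\<open>Cn\<close> is chosen before \<open>I\<close>, \<open>k\<close>, \<open>A\<close>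
  and \<open>f\<close>, which expresses the asserted uniformity of the constant.\<close>

theorem theorem4p1:
  fixes n :: nat and p q s :: real and C :: "nat \<Rightarrow> real"
  assumes "n \<ge> 2" and "1 \<le> p" and "p < 2" and "q > p"
    and "1 / s = real n * (1 / q)"
  shows "\<exists>Cn::real. \<forall>(I::real set) (k::nat \<Rightarrow> real \<Rightarrow> real \<Rightarrow> complex)
            (A::(nat \<times> nat) set) (f::nat \<Rightarrow> real \<Rightarrow> complex).
      I \<in> sets lebesgue \<longrightarrow>
      (\<forall>i\<in>{1..n}. (\<lambda>(l, x). k i l x) \<in> borel_measurable (lebesgue_on (I \<times> {0<..}))) \<longrightarrow>
      (\<forall>i\<in>{1..n}. kernel_bounded p q I (k i) (C i)) \<longrightarrow>
      A \<subseteq> {1..n} \<times> {1..n} \<longrightarrow>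
      (\<forall>i\<in>{1..n}. in_Lp p Rplus (f i)) \<longrightarrow>
      (AE l in lebesgue_on I. integrable (Rplus_power n) (multi_integrand n A k f l)) \<longrightarrow>
      in_Lp s (lebesgue_on I) (multi_op n A k f) \<and>
      Lp_norm s (lebesgue_on I) (multi_op n A k f) \<le> Cn * (\<Prod>i\<in>{1..n}. Lp_norm p Rplus (f i))"
proof -
  \<comment> \<open>A common bound for all kernels; the summand 1 keeps it positive whatever the
    \<open>C i\<close> are.\<close>
  define D where "D = 1 + (\<Sum>i\<in>{1..n}. \<bar>C i\<bar>)"
  define r where "r = min q 2"
  define \<theta> where "\<theta> = 2 powr ((r / p - 1) / 2)"
  define Cn where
    "Cn = tree_const \<theta> n * (n * (D powr r * (n + 2) powr (r / p)) * \<theta> / (\<theta> - 1)) powr (n / r)"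
  have D: "D > 0"
    unfolding D_def by (intro add_pos_nonneg sum_nonneg) auto
  have CD: "C i \<le> D" if "i \<in> {1..n}" for i
    unfolding D_def using member_le_sum[OF that, of "\<lambda>i. \<bar>C i\<bar>"] by auto
  have s: "s = q / n"
  proof -
    have "s = 1 / (1 / s)" by simp
    then show ?thesis unfolding assms(5) by simp
  qed
  have s0: "s > 0"
    using assms by (simp add: s)
  have "\<theta> > 1"
    using assms by (simp add: \<theta>_def r_def)
  then have Cn0: "Cn \<ge> 0"
    unfolding Cn_def using tree_const_ge_1[of \<theta> n] by simp
  show ?thesis
  proof (rule exI[of _ Cn], intro allI impI)
    fix I :: "real set" and k :: "nat \<Rightarrow> real \<Rightarrow> real \<Rightarrow> complex"
      and A :: "(nat \<times> nat) set" and f :: "nat \<Rightarrow> real \<Rightarrow> complex"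
    assume I: "I \<in> sets lebesgue"
      and k: "\<forall>i\<in>{1..n}. kernel_bounded p q I (k i) (C i)"
      and A: "A \<subseteq> {1..n} \<times> {1..n}"
      and f: "\<forall>i\<in>{1..n}. in_Lp p Rplus (f i)"
      and abs: "AE l in lebesgue_on I. integrable (Rplus_power n) (multi_integrand n A k f l)"
    let ?T = "multi_op n A k f"
    have kD: "kernel_bounded p q I (k i) D" if "i \<in> {1..n}" for i
      using k CD that by (blast intro: kernel_bounded_mono)
    \<comment> \<open>Windows exhausting the half-line; \<open>Suc N\<close> makes them nonempty and
      compact for every \<open>N\<close>.\<close>
    define B where "B N x \<longleftrightarrow> x \<in> {1 / real (Suc N)..real (Suc N)}" for N x
    define g where "g N i x = f i x * of_bool (B N x)" for N i x
    have B: "Measurable.pred Rplus (B N)" for N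
    proof -
      have "Measurable.pred lebesgue (B N)"
        unfolding B_def by (simp add: pred_def)
      then show ?thesis
        by (rule measurable_restrict_space1)
    qed
    have B_ev: "\<forall>\<^sub>F N in sequentially. B N x" if "x > 0" for x
    proof -
      obtain N0 where N0: "max x (1 / x) < real N0"
        using reals_Archimedean2 by blast
      show ?thesis
        using eventually_ge_at_top[of N0]
      proof eventually_elim
        fix N assume "N0 \<le> N"
        then have N: "max x (1 / x) < real (Suc N)"
          using N0 by linarith
        then have "1 / real (Suc N) < x"
          using that by (simp add: field_simps)
        with N show "B N x" by (simp add: B_def)
      qed
    qed
    have mi_g: "multi_integrand n A k (g N) l x = multi_integrand n A k f l x * of_bool (\<forall>i\<in>{1..n}. B N (x i))"
      for N l x
    proof -
      have "(\<Prod>i\<in>{1..n}. of_bool (B N (x i))) = (of_bool (\<forall>i\<in>{1..n}. B N (x i)) :: complex)"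
        by (induction n) (auto simp: atLeastAtMostSuc_conv)
      then show ?thesis
        unfolding multi_integrand_def g_def by (simp add: prod.distrib mult_ac)
    qed
    \<comment> \<open>The assumed absolute convergence supplies the majorant for removing the
      truncation.\<close>
    have lim: "AE l in lebesgue_on I. (\<lambda>N. multi_op n A k (g N) l) \<longlonglongrightarrow> ?T l"
      using abs
    proof eventually_elim
      fix l assume int: "integrable (Rplus_power n) (multi_integrand n A k f l)"
      have [measurable]: "multi_integrand n A k f l \<in> borel_measurable (Rplus_power n)"
        using int by auto
      show "(\<lambda>N. multi_op n A k (g N) l) \<longlonglongrightarrow> ?T l"
        unfolding multi_op_def
      proof (rule integral_dominated_convergence[where w = "\<lambda>x. norm (multi_integrand n A k f l x)"])
        fix N
        have "Measurable.pred (Rplus_power n) (\<lambda>x. \<forall>i\<in>{1..n}. B N (x i))"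
        proof (rule pred_intros_finite(3))
          fix i assume "i \<in> {1..n}"
          then show "Measurable.pred (Rplus_power n) (\<lambda>x. B N (x i))"
            using B by (intro measurable_compose[OF measurable_component_singleton])
        qed simp
        then show "multi_integrand n A k (g N) l \<in> borel_measurable (Rplus_power n)"
          unfolding mi_g by measurable
        show "AE x in Rplus_power n. norm (multi_integrand n A k (g N) l x) \<le> norm (multi_integrand n A k f l x)"
          unfolding mi_g by (simp add: norm_mult)
      next
        show "AE x in Rplus_power n. (\<lambda>N. multi_integrand n A k (g N) l x) \<longlonglongrightarrow> multi_integrand n A k f l x"
        proof (rule AE_I2)
          fix x assume "x \<in> space (Rplus_power n)"
          then have "x i > 0" if "i \<in> {1..n}" for i
            using that by (auto simp: space_PiM PiE_iff)
          then have "\<forall>\<^sub>F N in sequentially. \<forall>i\<in>{1..n}. B N (x i)"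
            by (intro eventually_ball_finite) (auto intro: B_ev)
          then have "\<forall>\<^sub>F N in sequentially. multi_integrand n A k (g N) l x = multi_integrand n A k f l x"
            by eventually_elim (simp add: mi_g)
          then show "(\<lambda>N. multi_integrand n A k (g N) l x) \<longlonglongrightarrow> multi_integrand n A k f l x"
            by (rule tendsto_eventually)
        qed
      qed (use int in simp_all)
    qed
    \<comment> \<open>The normalization divides by these bounds, while a norm may be 0; adding
      \<delta> keeps them positive until the final limit.\<close>
    let ?F = "\<lambda>\<delta> i. Lp_norm p Rplus (f i) + \<delta>"
    have bounds: "?T \<in> borel_measurable (lebesgue_on I)"
      "(\<integral>\<^sup>+l. ennreal (norm (?T l) powr s) \<partial>lebesgue_on I) \<le> ennreal ((Cn * (\<Prod>i\<in>{1..n}. ?F \<delta> i)) powr s)"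
      if \<delta>: "\<delta> > 0" for \<delta>
    proof -
      have gN: "multi_op n A k (g N) \<in> borel_measurable (lebesgue_on I)"
        "(\<integral>\<^sup>+l. ennreal (norm (multi_op n A k (g N) l) powr s) \<partial>lebesgue_on I)
            \<le> ennreal ((Cn * (\<Prod>i\<in>{1..n}. ?F \<delta> i)) powr s)" for N
      proof -
        have F: "?F \<delta> i > 0" for i
          using \<delta> by (intro add_nonneg_pos) (simp_all add: Lp_norm_def)
        have gLp: "in_Lp p Rplus (g N i)" if "i \<in> {1..n}" for i
          unfolding g_def using f that B by (intro in_Lp_restrict) auto
        have gF: "Lp_norm p Rplus (g N i) \<le> ?F \<delta> i" if "i \<in> {1..n}" for i
          unfolding g_def using in_Lp_restrict(2)[OF _ B, of p "f i" N] f that assms(2) \<delta> by fastforce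
        have eR: "0 < 1 / real (Suc N)" "1 / real (Suc N) \<le> real (Suc N)"
          using mult_mono[of 1 "real (Suc N)" 1 "real (Suc N)"] by (simp_all add: field_simps)
        have supp: "g N i x = 0" if "i \<in> {1..n}" "x > 0" "x \<notin> {1 / real (Suc N)..real (Suc N)}" for i x
          using that by (simp add: g_def B_def)
        note * = multi_op_bound_bounded_support[OF assms(1-4) s D I kD A gLp F gF eR supp]
        show "multi_op n A k (g N) \<in> borel_measurable (lebesgue_on I)"
          by (rule *(1))
        show "(\<integral>\<^sup>+l. ennreal (norm (multi_op n A k (g N) l) powr s) \<partial>lebesgue_on I)
            \<le> ennreal ((Cn * (\<Prod>i\<in>{1..n}. ?F \<delta> i)) powr s)"
          unfolding Cn_def \<theta>_def r_def by (rule *(2))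
      qed
      from powr_norm_limit_le[OF complete_measure_lebesgue_on[OF I] s0 gN(1) lim gN(2)]
      show "?T \<in> borel_measurable (lebesgue_on I)"
        "(\<integral>\<^sup>+l. ennreal (norm (?T l) powr s) \<partial>lebesgue_on I) \<le> ennreal ((Cn * (\<Prod>i\<in>{1..n}. ?F \<delta> i)) powr s)"
        by blast+
    qed
    have T_meas: "?T \<in> borel_measurable (lebesgue_on I)"
      using bounds(1)[of 1] by simp
    have int: "integrable (lebesgue_on I) (\<lambda>l. norm (?T l) powr s)"
    proof (rule integrableI_bounded)
      show "(\<lambda>l. norm (?T l) powr s) \<in> borel_measurable (lebesgue_on I)"
        using T_meas by measurable
      show "(\<integral>\<^sup>+l. ennreal (norm (norm (?T l) powr s)) \<partial>lebesgue_on I) < \<infinity>"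
        using bounds(2)[of 1] by (simp add: le_less_trans ennreal_less_top)
    qed
    have "Lp_norm s (lebesgue_on I) ?T \<le> Cn * (\<Prod>i\<in>{1..n}. ?F \<delta> i)" if \<delta>: "\<delta> > 0" for \<delta>
    proof -
      have P0: "Cn * (\<Prod>i\<in>{1..n}. ?F \<delta> i) \<ge> 0"
        using Cn0 \<delta> by (intro mult_nonneg_nonneg prod_nonneg) (auto simp: Lp_norm_def)
      have "(\<integral>l. norm (?T l) powr s \<partial>lebesgue_on I) \<le> (Cn * (\<Prod>i\<in>{1..n}. ?F \<delta> i)) powr s"
        using bounds(2)[OF \<delta>] nn_integral_eq_integral[OF int] by (simp add: ennreal_le_iff)
      then have "Lp_norm s (lebesgue_on I) ?T \<le> ((Cn * (\<Prod>i\<in>{1..n}. ?F \<delta> i)) powr s) powr (1 / s)"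
        unfolding Lp_norm_def using s0 by (intro powr_mono2) auto
      also have "\<dots> = Cn * (\<Prod>i\<in>{1..n}. ?F \<delta> i)"
        using s0 P0 by (simp add: powr_powr)
      finally show ?thesis .
    qed
    \<comment> \<open>The right side is continuous in \<delta>, so the inequality survives as
      \<delta> decreases to 0.\<close>
    then have "\<forall>\<^sub>F \<delta> in at_right 0. Lp_norm s (lebesgue_on I) ?T \<le> Cn * (\<Prod>i\<in>{1..n}. ?F \<delta> i)"
      by (auto intro: eventually_at_rightI[of 0 1])
    moreover have "((\<lambda>\<delta>. Cn * (\<Prod>i\<in>{1..n}. ?F \<delta> i)) \<longlongrightarrow> Cn * (\<Prod>i\<in>{1..n}. ?F 0 i)) (at_right 0)"
      by (intro tendsto_intros)
    ultimately have "Lp_norm s (lebesgue_on I) ?T \<le> Cn * (\<Prod>i\<in>{1..n}. ?F 0 i)"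
      by (intro tendsto_lowerbound) auto
    with T_meas int show "in_Lp s (lebesgue_on I) ?T \<and>
        Lp_norm s (lebesgue_on I) ?T \<le> Cn * (\<Prod>i\<in>{1..n}. Lp_norm p Rplus (f i))"
      by (simp add: in_Lp_def)
  qed
qed

end
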